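(* Let $G$ be a locally graded non-sofic group. Then $G$ contains a finitely generated non-sofic subgroup $H$ and a strictly decreasing sequence of finitely generated normal subgroups $H=N_0>N_1>N_2>\cdots$ of $H$ such that: (i) each $N_i$ is non-sofic; (ii) the intersection $R=\bigcap_{i=0}^\infty N_i$ is non-trivial and is contained in the profinite residual of $H$; (iii) $H/R$ is residually finite. In particular, $G$ is $\omega$-non-sofic.
   Context: For $n\ge 1$, the normalized Hamming metric on the symmetric group $S_n$ is $d_{\mathrm{hamm}}(\sigma,\tau)=\frac1n\#\{i:\sigma(i)\ne\tau(i)\}$. A group $G$ is sofic if there exist a set $A$, an ultrafilter $\mathcal U$ on $A$ and a map $\alpha\mapsto n(\alpha)$ from $A$ to the positive integers such that $G$ is isomorphic to a subgroup of the metric ultraproduct $\prod_{\alpha\in A}(S_{n(\alpha)},d_{\mathrm{hamm}})/\mathcal U$, i.e. the quotient of $\prod_{\alpha} S_{n(\alpha)}$ by the normal subgroup of all $(\sigma_\alpha)$ with $\lim_{\alpha\to\mathcal U} d_{\mathrm{hamm}}(\sigma_\alpha,\mathrm{Id})=0$. A non-sofic group is called $\omega$-non-sofic if it admits an infinite strictly descending chain $H_0>H_1>H_2>\cdots$ of non-sofic subgroups. A group is locally graded if every non-trivial finitely generated subgroup has a proper subgroup of finite index. The profinite residual of $H$ is the intersection of all normal subgroups of finite index in $H$. *)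

theory Defs
  imports "HOL-Algebra.Sym_Groups" "HOL-Algebra.Product_Groups" Complex_Main
begin

definition hamming_dist :: "nat \<Rightarrow> (nat \<Rightarrow> nat) \<Rightarrow> (nat \<Rightarrow> nat) \<Rightarrow> real" where
  "hamming_dist n \<sigma> \<tau> = real (card {i \<in> {1..n}. \<sigma> i \<noteq> \<tau> i}) / real n"

text \<open>An ultrafilter on a set \<open>A\<close>, represented as a filter on the ambient type that
  concentrates on \<open>A\<close>. Principal ultrafilters are allowed.\<close>

definition ultrafilter_on :: "'i set \<Rightarrow> 'i filter \<Rightarrow> bool" where
  "ultrafilter_on A U \<longleftrightarrow> U \<noteq> bot \<and> U \<le> principal A \<and>
     (\<forall>P. eventually P U \<or> eventually (\<lambda>x. \<not> P x) U)"

definition null_sequences :: "'i set \<Rightarrow> 'i filter \<Rightarrow> ('i \<Rightarrow> nat) \<Rightarrow> ('i \<Rightarrow> nat \<Rightarrow> nat) set" where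
  "null_sequences A U n =
     {\<sigma> \<in> carrier (product_group A (\<lambda>\<alpha>. sym_group (n \<alpha>))).
        ((\<lambda>\<alpha>. hamming_dist (n \<alpha>) (\<sigma> \<alpha>) id) \<longlongrightarrow> 0) U}"

definition metric_ultraproduct ::
    "'i set \<Rightarrow> 'i filter \<Rightarrow> ('i \<Rightarrow> nat) \<Rightarrow> ('i \<Rightarrow> nat \<Rightarrow> nat) set monoid" where
  "metric_ultraproduct A U n =
     product_group A (\<lambda>\<alpha>. sym_group (n \<alpha>)) Mod null_sequences A U n"

definition sofic_wrt ::
    "'i set \<Rightarrow> 'i filter \<Rightarrow> ('i \<Rightarrow> nat) \<Rightarrow> ('a, 'b) monoid_scheme \<Rightarrow> bool" where
  "sofic_wrt A U n G \<longleftrightarrow> ultrafilter_on A U \<and> (\<forall>\<alpha>\<in>A. 0 < n \<alpha>) \<and>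
     (\<exists>K. subgroup K (metric_ultraproduct A U n) \<and>
          G \<cong> (metric_ultraproduct A U n)\<lparr>carrier := K\<rparr>)"

text \<open>The index set \<open>A\<close> is arbitrary, but HOL cannot quantify existentially over types, so \<open>A\<close>
  ranges over the subsets of one fixed type. Nothing is lost: by \<open>sofic_wrt_imp_sofic\<close> below, an
  index set in any type whatsoever can be replaced by one in this type.\<close>

definition sofic :: "('a, 'b) monoid_scheme \<Rightarrow> bool" where
  "sofic G \<longleftrightarrow> (\<exists>(A :: ('a set \<times> nat) set) U n. sofic_wrt A U n G)"

definition finitely_generated :: "('a, 'b) monoid_scheme \<Rightarrow> bool" where
  "finitely_generated G \<longleftrightarrow> (\<exists>S. finite S \<and> S \<subseteq> carrier G \<and> generate G S = carrier G)"

definition finite_index :: "'a set \<Rightarrow> ('a, 'b) monoid_scheme \<Rightarrow> bool" where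
  "finite_index H G \<longleftrightarrow> finite (rcosets\<^bsub>G\<^esub> H)"

definition locally_graded :: "('a, 'b) monoid_scheme \<Rightarrow> bool" where
  "locally_graded G \<longleftrightarrow>
     (\<forall>H. subgroup H G \<and> finitely_generated (G\<lparr>carrier := H\<rparr>) \<and> H \<noteq> {\<one>\<^bsub>G\<^esub>} \<longrightarrow>
          (\<exists>L. subgroup L (G\<lparr>carrier := H\<rparr>) \<and> L \<noteq> H \<and> finite_index L (G\<lparr>carrier := H\<rparr>)))"

definition profinite_residual :: "('a, 'b) monoid_scheme \<Rightarrow> 'a set" where
  "profinite_residual G = \<Inter> {N. N \<lhd> G \<and> finite_index N G}"

definition residually_finite :: "('a, 'b) monoid_scheme \<Rightarrow> bool" where
  "residually_finite G \<longleftrightarrow>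
     (\<forall>x \<in> carrier G - {\<one>\<^bsub>G\<^esub>}. \<exists>N. N \<lhd> G \<and> finite_index N G \<and> x \<notin> N)"

definition omega_non_sofic :: "('a, 'b) monoid_scheme \<Rightarrow> bool" where
  "omega_non_sofic G \<longleftrightarrow> \<not> sofic G \<and>
     (\<exists>H :: nat \<Rightarrow> 'a set.
        (\<forall>i. subgroup (H i) G \<and> \<not> sofic (G\<lparr>carrier := H i\<rparr>) \<and> H (Suc i) \<subset> H i))"


lemma hamming_dist_nonneg: "0 \<le> hamming_dist n \<sigma> \<tau>"
  by (simp add: hamming_dist_def)

lemma hamming_dist_comp_le:
  "hamming_dist n (\<sigma> \<circ> \<tau>) id \<le> hamming_dist n \<sigma> id + hamming_dist n \<tau> id"
proof -
  have "card {i \<in> {1..n}. (\<sigma> \<circ> \<tau>) i \<noteq> id i}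
      \<le> card ({i \<in> {1..n}. \<sigma> i \<noteq> id i} \<union> {i \<in> {1..n}. \<tau> i \<noteq> id i})"
    by (intro card_mono) auto
  also have "\<dots> \<le> card {i \<in> {1..n}. \<sigma> i \<noteq> id i} + card {i \<in> {1..n}. \<tau> i \<noteq> id i}"
    by (rule card_Un_le)
  finally have "real (card {i \<in> {1..n}. (\<sigma> \<circ> \<tau>) i \<noteq> id i})
      \<le> real (card {i \<in> {1..n}. \<sigma> i \<noteq> id i}) + real (card {i \<in> {1..n}. \<tau> i \<noteq> id i})"
    by (simp only: of_nat_add[symmetric] of_nat_le_iff)
  thus ?thesis
    unfolding hamming_dist_def add_divide_distrib[symmetric] by (rule divide_right_mono) simp
qed

lemma hamming_dist_inv:
  assumes "\<sigma> permutes {1..n}"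
  shows "hamming_dist n (inv' \<sigma>) id = hamming_dist n \<sigma> id"
proof -
  have "{i \<in> {1..n}. inv' \<sigma> i \<noteq> id i} = {i \<in> {1..n}. \<sigma> i \<noteq> id i}"
    by (rule Collect_cong) (metis assms id_apply permutes_inv_eq)
  thus ?thesis by (simp add: hamming_dist_def)
qed

lemma hamming_dist_conj:
  assumes "\<tau> permutes {1..n}"
  shows "hamming_dist n (\<tau> \<circ> \<sigma> \<circ> inv' \<tau>) id = hamming_dist n \<sigma> id"
proof -
  have "bij_betw \<tau> {i \<in> {1..n}. \<sigma> i \<noteq> id i} {i \<in> {1..n}. (\<tau> \<circ> \<sigma> \<circ> inv' \<tau>) i \<noteq> id i}"
  proof (rule bij_betwI[where g = "inv' \<tau>"])
    show "\<tau> \<in> {i \<in> {1..n}. \<sigma> i \<noteq> id i} \<rightarrow> {i \<in> {1..n}. (\<tau> \<circ> \<sigma> \<circ> inv' \<tau>) i \<noteq> id i}"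
      using assms permutes_in_image[OF assms] permutes_inverses[OF assms]
        permutes_inj[OF assms] by (auto simp: inj_eq simp del: atLeastAtMost_iff)
    show "inv' \<tau> \<in> {i \<in> {1..n}. (\<tau> \<circ> \<sigma> \<circ> inv' \<tau>) i \<noteq> id i} \<rightarrow> {i \<in> {1..n}. \<sigma> i \<noteq> id i}"
      using assms permutes_in_image[OF permutes_inv[OF assms]] permutes_inverses[OF assms]
      by (auto simp del: atLeastAtMost_iff)
  qed (simp_all add: permutes_inverses[OF assms])
  from bij_betw_same_card[OF this] show ?thesis by (simp add: hamming_dist_def)
qed

lemma group_product_sym: "group (product_group A (\<lambda>\<alpha>. sym_group (n \<alpha>)))"
  by (simp add: sym_group_is_group)

lemma eventually_ultrafilter_on:
  assumes "ultrafilter_on A U"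
  shows "eventually (\<lambda>\<alpha>. \<alpha> \<in> A) U"
  using assms by (auto simp: ultrafilter_on_def le_principal)

lemma null_sequences_iff:
  assumes "ultrafilter_on A U"
    and "\<sigma> \<in> carrier (product_group A (\<lambda>\<alpha>. sym_group (n \<alpha>)))"
    and "\<And>\<alpha>. \<alpha> \<in> A \<Longrightarrow> hamming_dist (n \<alpha>) (\<sigma> \<alpha>) id = f \<alpha>"
  shows "\<sigma> \<in> null_sequences A U n \<longleftrightarrow> (f \<longlongrightarrow> 0) U"
proof -
  have "((\<lambda>\<alpha>. hamming_dist (n \<alpha>) (\<sigma> \<alpha>) id) \<longlongrightarrow> 0) U \<longleftrightarrow> (f \<longlongrightarrow> 0) U"
    by (rule tendsto_cong, use eventually_ultrafilter_on[OF assms(1)] in eventually_elim)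
       (use assms(3) in auto)
  thus ?thesis using assms(2) by (simp add: null_sequences_def)
qed

lemma null_sequences_normal:
  assumes U: "ultrafilter_on A U"
  shows "null_sequences A U n \<lhd> product_group A (\<lambda>\<alpha>. sym_group (n \<alpha>))" (is "?N \<lhd> ?P")
proof -
  interpret P: group ?P by (rule group_product_sym)
  have car: "\<sigma> \<in> carrier ?P \<Longrightarrow> \<alpha> \<in> A \<Longrightarrow> \<sigma> \<alpha> \<in> carrier (sym_group (n \<alpha>))" for \<sigma> \<alpha>
    by (auto simp: PiE_iff)
  have perm: "\<sigma> \<in> carrier ?P \<Longrightarrow> \<alpha> \<in> A \<Longrightarrow> \<sigma> \<alpha> permutes {1..n \<alpha>}" for \<sigma> \<alpha>
    using car by (auto simp: sym_group_carrier)
  have mult: "\<alpha> \<in> A \<Longrightarrow> (\<sigma> \<otimes>\<^bsub>?P\<^esub> \<tau>) \<alpha> = \<sigma> \<alpha> \<circ> \<tau> \<alpha>" for \<sigma> \<tau> \<alpha>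
    by (simp add: sym_group_mult)
  have inv: "\<sigma> \<in> carrier ?P \<Longrightarrow> \<alpha> \<in> A \<Longrightarrow> (inv\<^bsub>?P\<^esub> \<sigma>) \<alpha> = inv' (\<sigma> \<alpha>)" for \<sigma> \<alpha>
    using car by (simp add: sym_group_is_group)
  have lim: "\<sigma> \<in> ?N \<Longrightarrow> ((\<lambda>\<alpha>. hamming_dist (n \<alpha>) (\<sigma> \<alpha>) id) \<longlongrightarrow> 0) U" for \<sigma>
    by (simp add: null_sequences_def)
  have carN: "\<sigma> \<in> ?N \<Longrightarrow> \<sigma> \<in> carrier ?P" for \<sigma>
    by (simp add: null_sequences_def)
  have "subgroup ?N ?P"
  proof (rule P.subgroupI)
    show "?N \<subseteq> carrier ?P" using carN by blast
    have "\<one>\<^bsub>?P\<^esub> \<in> ?N"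
      by (subst null_sequences_iff[OF U, where f = "\<lambda>_. 0"])
         (auto simp: hamming_dist_def sym_group_one sym_group_carrier permutes_id)
    thus "?N \<noteq> {}" by blast
  next
    fix \<sigma> assume \<sigma>: "\<sigma> \<in> ?N"
    show "inv\<^bsub>?P\<^esub> \<sigma> \<in> ?N"
      using lim[OF \<sigma>] carN[OF \<sigma>]
      by (subst null_sequences_iff[OF U _ , where f = "\<lambda>\<alpha>. hamming_dist (n \<alpha>) (\<sigma> \<alpha>) id"])
         (simp_all only: P.inv_closed inv hamming_dist_inv perm)
  next
    fix \<sigma> \<tau> assume \<sigma>: "\<sigma> \<in> ?N" and \<tau>: "\<tau> \<in> ?N"
    have "((\<lambda>\<alpha>. hamming_dist (n \<alpha>) (\<sigma> \<alpha> \<circ> \<tau> \<alpha>) id) \<longlongrightarrow> 0) U"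
      by (rule tendsto_sandwich[OF _ _ tendsto_const tendsto_add_zero[OF lim[OF \<sigma>] lim[OF \<tau>]]])
         (auto simp: hamming_dist_nonneg hamming_dist_comp_le)
    thus "\<sigma> \<otimes>\<^bsub>?P\<^esub> \<tau> \<in> ?N"
      using carN[OF \<sigma>] carN[OF \<tau>]
      by (subst null_sequences_iff[OF U _ , where f = "\<lambda>\<alpha>. hamming_dist (n \<alpha>) (\<sigma> \<alpha> \<circ> \<tau> \<alpha>) id"])
         (simp_all only: P.m_closed mult)
  qed
  moreover have "\<tau> \<otimes>\<^bsub>?P\<^esub> \<sigma> \<otimes>\<^bsub>?P\<^esub> inv\<^bsub>?P\<^esub> \<tau> \<in> ?N" if \<tau>: "\<tau> \<in> carrier ?P" and \<sigma>: "\<sigma> \<in> ?N" for \<tau> \<sigma>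
    using lim[OF \<sigma>] carN[OF \<sigma>] \<tau>
    by (subst null_sequences_iff[OF U _ , where f = "\<lambda>\<alpha>. hamming_dist (n \<alpha>) (\<sigma> \<alpha>) id"])
       (simp_all only: P.m_closed P.inv_closed mult inv hamming_dist_conj perm)
  ultimately show ?thesis by (rule P.normal_invI)
qed

lemma embeds_in_factor_iff:
  fixes G :: "('a, 'b) monoid_scheme" and P :: "('c, 'd) monoid_scheme"
  assumes "group G" and "N \<lhd> P"
  shows "(\<exists>K. subgroup K (P Mod N) \<and> G \<cong> (P Mod N)\<lparr>carrier := K\<rparr>) \<longleftrightarrow>
     (\<exists>s. s \<in> carrier G \<rightarrow> carrier P \<and>
        (\<forall>g\<in>carrier G. \<forall>h\<in>carrier G. s (g \<otimes>\<^bsub>G\<^esub> h) \<otimes>\<^bsub>P\<^esub> inv\<^bsub>P\<^esub> (s g \<otimes>\<^bsub>P\<^esub> s h) \<in> N) \<and>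
        (\<forall>g\<in>carrier G. g \<noteq> \<one>\<^bsub>G\<^esub> \<longrightarrow> s g \<notin> N))" (is "?L \<longleftrightarrow> ?R")
proof
  interpret G: group G by fact
  interpret N: normal N P by fact
  interpret Q: group "P Mod N" by (rule N.factorgroup_is_group)
  note sub = N.subgroup_axioms
  {
    assume ?L
    then obtain K \<phi> where K: "subgroup K (P Mod N)"
      and \<phi>: "\<phi> \<in> iso G ((P Mod N)\<lparr>carrier := K\<rparr>)"
      by (auto simp: is_iso_def)
    have \<phi>K: "\<phi> g \<in> K" if "g \<in> carrier G" for g
      using \<phi> that by (auto simp: iso_def hom_def)
    have \<phi>m: "\<phi> (g \<otimes>\<^bsub>G\<^esub> h) = \<phi> g <#>\<^bsub>P\<^esub> \<phi> h" if "g \<in> carrier G" "h \<in> carrier G" for g h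
      using \<phi> that by (auto simp: iso_def hom_def FactGroup_def)
    have KQ: "K \<subseteq> rcosets\<^bsub>P\<^esub> N"
      using subgroup.subset[OF K] by (simp add: FactGroup_def)
    have "\<exists>x. x \<in> carrier P \<and> \<phi> g = N #>\<^bsub>P\<^esub> x" if "g \<in> carrier G" for g
      using \<phi>K[OF that] KQ by (auto simp: RCOSETS_def)
    then obtain s where s: "\<And>g. g \<in> carrier G \<Longrightarrow> s g \<in> carrier P"
      and \<phi>s: "\<And>g. g \<in> carrier G \<Longrightarrow> \<phi> g = N #>\<^bsub>P\<^esub> s g"
      by metis
    have "s (g \<otimes>\<^bsub>G\<^esub> h) \<otimes>\<^bsub>P\<^esub> inv\<^bsub>P\<^esub> (s g \<otimes>\<^bsub>P\<^esub> s h) \<in> N"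
      if g: "g \<in> carrier G" and h: "h \<in> carrier G" for g h
    proof -
      have "N #>\<^bsub>P\<^esub> s (g \<otimes>\<^bsub>G\<^esub> h) = N #>\<^bsub>P\<^esub> (s g \<otimes>\<^bsub>P\<^esub> s h)"
        using \<phi>m[OF g h] \<phi>s g h N.rcos_sum[OF s[OF g] s[OF h]] by simp
      hence "s (g \<otimes>\<^bsub>G\<^esub> h) \<in> N #>\<^bsub>P\<^esub> (s g \<otimes>\<^bsub>P\<^esub> s h)"
        using N.rcos_self[OF s[of "g \<otimes>\<^bsub>G\<^esub> h"] sub] g h by simp
      thus ?thesis
        using N.rcos_module_imp[OF N.is_group, of "s g \<otimes>\<^bsub>P\<^esub> s h"] s g h by simp
    qed
    moreover have "s g \<notin> N" if g: "g \<in> carrier G" and "g \<noteq> \<one>\<^bsub>G\<^esub>" for g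
    proof
      assume "s g \<in> N"
      hence "\<phi> g = \<one>\<^bsub>P Mod N\<^esub>"
        using \<phi>s[OF g] N.coset_join2[OF s[OF g] sub] by simp
      moreover have "\<phi> \<one>\<^bsub>G\<^esub> = \<one>\<^bsub>P Mod N\<^esub>"
        using hom_one[of \<phi> G "(P Mod N)\<lparr>carrier := K\<rparr>"] \<phi> Q.subgroup_imp_group[OF K]
        by (simp add: iso_def G.is_group)
      ultimately have "\<phi> g = \<phi> \<one>\<^bsub>G\<^esub>" by simp
      moreover have "inj_on \<phi> (carrier G)" using \<phi> by (auto simp: iso_def bij_betw_def)
      ultimately show False using g \<open>g \<noteq> \<one>\<^bsub>G\<^esub>\<close> by (auto dest: inj_onD)
    qed
    ultimately show ?R using s by blast
  next
    assume ?R
    then obtain s where s: "\<And>g. g \<in> carrier G \<Longrightarrow> s g \<in> carrier P"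
      and sm: "\<And>g h. g \<in> carrier G \<Longrightarrow> h \<in> carrier G \<Longrightarrow>
                 s (g \<otimes>\<^bsub>G\<^esub> h) \<otimes>\<^bsub>P\<^esub> inv\<^bsub>P\<^esub> (s g \<otimes>\<^bsub>P\<^esub> s h) \<in> N"
      and s1: "\<And>g. g \<in> carrier G \<Longrightarrow> g \<noteq> \<one>\<^bsub>G\<^esub> \<Longrightarrow> s g \<notin> N"
      by blast
    define \<phi> where "\<phi> = (\<lambda>g. N #>\<^bsub>P\<^esub> s g)"
    have "\<phi> \<in> hom G (P Mod N)"
    proof (rule homI)
      fix g h assume g: "g \<in> carrier G" and h: "h \<in> carrier G"
      have "s (g \<otimes>\<^bsub>G\<^esub> h) \<in> N #>\<^bsub>P\<^esub> (s g \<otimes>\<^bsub>P\<^esub> s h)"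
        using N.rcos_module_rev[OF N.is_group _ _ sm[OF g h]] s g h by simp
      hence "N #>\<^bsub>P\<^esub> (s g \<otimes>\<^bsub>P\<^esub> s h) = N #>\<^bsub>P\<^esub> s (g \<otimes>\<^bsub>G\<^esub> h)"
        using N.repr_independence sub s g h by simp
      thus "\<phi> (g \<otimes>\<^bsub>G\<^esub> h) = \<phi> g \<otimes>\<^bsub>P Mod N\<^esub> \<phi> h"
        using N.rcos_sum[OF s[OF g] s[OF h]] by (simp add: \<phi>_def FactGroup_def)
    qed (auto simp: \<phi>_def FactGroup_def RCOSETS_def s)
    then interpret \<phi>: group_hom G "P Mod N" \<phi> by unfold_locales
    have "inj_on \<phi> (carrier G)"
    proof (subst \<phi>.inj_on_one_iff, intro allI impI)
      fix g assume g: "g \<in> carrier G" "\<phi> g = \<one>\<^bsub>P Mod N\<^esub>"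
      hence "s g \<in> N" using N.rcos_self[OF s[OF g(1)] sub] by (simp add: \<phi>_def)
      thus "g = \<one>\<^bsub>G\<^esub>" using s1 g by blast
    qed
    hence "\<phi> \<in> iso G ((P Mod N)\<lparr>carrier := \<phi> ` carrier G\<rparr>)"
      by (auto simp: iso_def hom_def bij_betw_def)
    moreover have "subgroup (\<phi> ` carrier G) (P Mod N)"
      by (rule \<phi>.img_is_subgroup)
    ultimately show ?L by (auto simp: is_iso_def)
  }
qed

lemma ultrafilter_exists:
  fixes F :: "'i filter"
  assumes "F \<noteq> bot"
  shows "\<exists>U \<le> F. ultrafilter_on UNIV U"
proof -
  let ?S = "{F'. F' \<le> F \<and> F' \<noteq> bot}"
  let ?r = "\<lambda>a b :: 'i filter. b \<le> a"
  have "\<exists>m\<in>?S. \<forall>a\<in>?S. ?r m a \<longrightarrow> a = m"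
  proof (rule predicate_Zorn)
    show "partial_order_on ?S (relation_of ?r ?S)"
      by (rule partial_order_on_relation_ofI) auto
  next
    fix C assume C: "C \<in> Chains (relation_of ?r ?S)"
    show "\<exists>u\<in>?S. \<forall>a\<in>C. ?r a u"
    proof (cases "C = {}")
      case True
      thus ?thesis using assms by auto
    next
      case False
      have lin: "a \<le> b \<or> b \<le> a" and mem: "a \<in> ?S" if "a \<in> C" "b \<in> C" for a b
        using C that unfolding Chains_def relation_of_def by auto
      have "eventually P (Inf C) \<longleftrightarrow> (\<exists>b\<in>C. eventually P b)" for P
        by (rule eventually_Inf_base[OF False]) (metis lin inf.absorb1 inf.absorb2 order_refl)
      hence "Inf C \<noteq> bot"
        using mem by (auto simp: trivial_limit_def)
      moreover obtain c where "c \<in> C" using False by blast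
      ultimately show ?thesis
        using mem by (intro bexI[of _ "Inf C"]) (auto intro: Inf_lower2)
    qed
  qed
  then obtain U where U: "U \<le> F" "U \<noteq> bot"
    and max: "\<And>V. V \<le> F \<Longrightarrow> V \<noteq> bot \<Longrightarrow> V \<le> U \<Longrightarrow> V = U"
    by auto
  have "eventually P U \<or> eventually (\<lambda>x. \<not> P x) U" for P
  proof (rule disjCI)
    assume "\<not> eventually (\<lambda>x. \<not> P x) U"
    hence "inf U (principal {x. P x}) \<noteq> bot"
      by (auto simp: trivial_limit_def eventually_inf_principal)
    hence "inf U (principal {x. P x}) = U"
      using U(1) by (intro max) (auto intro: le_infI1)
    moreover have "eventually P (inf U (principal {x. P x}))"
      by (simp add: eventually_inf_principal)
    ultimately show "eventually P U" by simp
  qed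
  thus ?thesis using U by (auto simp: ultrafilter_on_def)
qed

text \<open>For every finite \<open>F\<close> and every \<open>k\<close> choose one index at which the lifted embedding is
  multiplicative on \<open>F\<close> up to \<open>1/(k+1)\<close> and keeps the non-trivial elements of \<open>F\<close> away from
  the identity; the pairs \<open>(F, k)\<close> then serve as new index set.\<close>

theorem sofic_wrt_imp_sofic:
  fixes G :: "('a, 'b) monoid_scheme" and A :: "'i set"
  assumes G: "group G" and sof: "sofic_wrt A U n G"
  shows "sofic G"
proof -
  let ?P = "product_group A (\<lambda>\<alpha>. sym_group (n \<alpha>))"
  let ?N = "null_sequences A U n"
  let ?C = "carrier G"
  interpret G: group G by (rule G)
  interpret P: group ?P by (rule group_product_sym)
  from sof have U: "ultrafilter_on A U" and n: "\<And>\<alpha>. \<alpha> \<in> A \<Longrightarrow> 0 < n \<alpha>"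
    and "\<exists>K. subgroup K (?P Mod ?N) \<and> G \<cong> (?P Mod ?N)\<lparr>carrier := K\<rparr>"
    by (auto simp: sofic_wrt_def metric_ultraproduct_def)
  then obtain s where s: "\<And>g. g \<in> ?C \<Longrightarrow> s g \<in> carrier ?P"
    and sm: "\<And>g h. g \<in> ?C \<Longrightarrow> h \<in> ?C \<Longrightarrow>
               s (g \<otimes>\<^bsub>G\<^esub> h) \<otimes>\<^bsub>?P\<^esub> inv\<^bsub>?P\<^esub> (s g \<otimes>\<^bsub>?P\<^esub> s h) \<in> ?N"
    and s1: "\<And>g. g \<in> ?C \<Longrightarrow> g \<noteq> \<one>\<^bsub>G\<^esub> \<Longrightarrow> s g \<notin> ?N"
    unfolding embeds_in_factor_iff[OF G null_sequences_normal[OF U]] by (blast dest: funcset_mem)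
  define d where "d = (\<lambda>g \<alpha>. hamming_dist (n \<alpha>) (s g \<alpha>) id)"
  define f where "f = (\<lambda>g h \<alpha>. hamming_dist (n \<alpha>) (s (g \<otimes>\<^bsub>G\<^esub> h) \<alpha> \<circ> inv' (s g \<alpha> \<circ> s h \<alpha>)) id)"
  have car: "s g \<alpha> \<in> carrier (sym_group (n \<alpha>))" if "g \<in> ?C" "\<alpha> \<in> A" for g \<alpha>
    using s[OF that(1)] that(2) by (auto simp: PiE_iff)
  have f0: "(f g h \<longlongrightarrow> 0) U" if "g \<in> ?C" "h \<in> ?C" for g h
  proof -
    have "hamming_dist (n \<alpha>) ((s (g \<otimes>\<^bsub>G\<^esub> h) \<otimes>\<^bsub>?P\<^esub> inv\<^bsub>?P\<^esub> (s g \<otimes>\<^bsub>?P\<^esub> s h)) \<alpha>) id = f g h \<alpha>"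
      if "\<alpha> \<in> A" for \<alpha>
    proof -
      have "s g \<otimes>\<^bsub>?P\<^esub> s h \<in> carrier ?P" using s \<open>g \<in> ?C\<close> \<open>h \<in> ?C\<close> by (intro P.m_closed)
      hence "(inv\<^bsub>?P\<^esub> (s g \<otimes>\<^bsub>?P\<^esub> s h)) \<alpha> = inv\<^bsub>sym_group (n \<alpha>)\<^esub> ((s g \<otimes>\<^bsub>?P\<^esub> s h) \<alpha>)"
        using \<open>\<alpha> \<in> A\<close> by (subst inv_product_group) (auto simp: sym_group_is_group)
      moreover have "(s g \<otimes>\<^bsub>?P\<^esub> s h) \<alpha> = s g \<alpha> \<circ> s h \<alpha>"
        using \<open>\<alpha> \<in> A\<close> by (simp add: sym_group_mult)
      moreover have "s g \<alpha> \<circ> s h \<alpha> \<in> carrier (sym_group (n \<alpha>))"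
        using car[OF \<open>g \<in> ?C\<close> \<open>\<alpha> \<in> A\<close>] car[OF \<open>h \<in> ?C\<close> \<open>\<alpha> \<in> A\<close>]
        by (auto simp: sym_group_carrier intro: permutes_compose)
      ultimately show ?thesis
        using \<open>\<alpha> \<in> A\<close> by (simp add: f_def sym_group_mult)
    qed
    moreover have "s (g \<otimes>\<^bsub>G\<^esub> h) \<otimes>\<^bsub>?P\<^esub> inv\<^bsub>?P\<^esub> (s g \<otimes>\<^bsub>?P\<^esub> s h) \<in> carrier ?P"
      using s that by (intro P.m_closed P.inv_closed G.m_closed) auto
    ultimately show ?thesis
      using null_sequences_iff[OF U] sm[OF that] by blast
  qed
  have "\<exists>e>0. eventually (\<lambda>\<alpha>. e \<le> d g \<alpha>) U" if g: "g \<in> ?C" "g \<noteq> \<one>\<^bsub>G\<^esub>" for g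
  proof -
    have "\<not> (d g \<longlongrightarrow> 0) U"
      using s1[OF g] null_sequences_iff[OF U s[OF g(1)]] by (auto simp: d_def)
    then obtain e where e: "e > 0" "\<not> eventually (\<lambda>\<alpha>. dist (d g \<alpha>) 0 < e) U"
      by (auto simp: tendsto_iff)
    have "eventually (\<lambda>\<alpha>. \<not> dist (d g \<alpha>) 0 < e) U"
      using U e(2) unfolding ultrafilter_on_def by blast
    hence "eventually (\<lambda>\<alpha>. e \<le> d g \<alpha>) U"
      by eventually_elim (simp add: d_def hamming_dist_nonneg not_less)
    thus ?thesis using e(1) by blast
  qed
  then obtain e where e0: "\<And>g. g \<in> ?C \<Longrightarrow> g \<noteq> \<one>\<^bsub>G\<^esub> \<Longrightarrow> 0 < e g"
    and e: "\<And>g. g \<in> ?C \<Longrightarrow> g \<noteq> \<one>\<^bsub>G\<^esub> \<Longrightarrow> eventually (\<lambda>\<alpha>. e g \<le> d g \<alpha>) U"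
    by metis

  define Good where "Good = (\<lambda>F k \<alpha>. \<alpha> \<in> A \<and>
     (\<forall>g\<in>F \<inter> ?C. \<forall>h\<in>F \<inter> ?C. f g h \<alpha> < inverse (real (Suc k))) \<and>
     (\<forall>g\<in>F \<inter> ?C - {\<one>\<^bsub>G\<^esub>}. e g \<le> d g \<alpha>))"
  have "\<exists>\<alpha>. Good F k \<alpha>" if "finite F" for F k
  proof -
    have "eventually (\<lambda>\<alpha>. f g h \<alpha> < inverse (real (Suc k))) U" if "g \<in> ?C" "h \<in> ?C" for g h
      by (rule order_tendstoD(2)[OF f0[OF that]]) simp
    hence "eventually (Good F k) U"
      unfolding Good_def using \<open>finite F\<close> e eventually_ultrafilter_on[OF U]
      by (intro eventually_conj eventually_ball_finite ballI) auto
    moreover have "U \<noteq> bot" using U by (simp add: ultrafilter_on_def)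
    ultimately show ?thesis using eventually_happens' by blast
  qed
  hence "\<exists>\<alpha>. Good (if finite F then F else {}) k \<alpha>" for F k
    by simp
  then obtain a where "\<And>F k. Good (if finite F then F else {}) k (a F k)"
    by metis
  hence aA: "a F k \<in> A" and a: "finite F \<Longrightarrow> Good F k (a F k)" for F k
    by (auto simp: Good_def split: if_splits)

  let ?B = "UNIV :: ('a set \<times> nat) set"
  let ?F = "finite_subsets_at_top (UNIV :: 'a set) \<times>\<^sub>F (sequentially :: nat filter)"
  have "?F \<noteq> bot" by (simp add: prod_filter_eq_bot)
  then obtain V where V: "V \<le> ?F" "ultrafilter_on ?B V"
    using ultrafilter_exists by blast
  have ev: "eventually Q V" if "finite F" "\<And>F' k'. finite F' \<Longrightarrow> F \<subseteq> F' \<Longrightarrow> k \<le> k' \<Longrightarrow> Q (F', k')"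
    for F k Q
  proof (rule filter_leD[OF V(1)])
    have "eventually (\<lambda>F'. finite F' \<and> F \<subseteq> F') (finite_subsets_at_top UNIV)"
      using \<open>finite F\<close> by (auto simp: eventually_finite_subsets_at_top)
    thus "eventually Q ?F"
      unfolding eventually_prod_filter
      using that(2) eventually_ge_at_top[of k] by blast
  qed
  define m where "m = (\<lambda>(F, k). n (a F k))"
  define t where "t = (\<lambda>g (F, k). s g (a F k))"
  let ?P' = "product_group ?B (\<lambda>\<beta>. sym_group (m \<beta>))"
  let ?N' = "null_sequences ?B V m"
  interpret P': group ?P' by (rule group_product_sym)
  have car': "t g \<beta> \<in> carrier (sym_group (m \<beta>))" if "g \<in> ?C" for g \<beta>
    using car[OF that aA] by (auto simp: t_def m_def split: prod.splits)
  have t: "t g \<in> carrier ?P'" if "g \<in> ?C" for g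
    using car'[OF that] by (auto simp: PiE_iff)
  have tm: "t (g \<otimes>\<^bsub>G\<^esub> h) \<otimes>\<^bsub>?P'\<^esub> inv\<^bsub>?P'\<^esub> (t g \<otimes>\<^bsub>?P'\<^esub> t h) \<in> ?N'"
    if g: "g \<in> ?C" and h: "h \<in> ?C" for g h
  proof -
    have "t g \<otimes>\<^bsub>?P'\<^esub> t h \<in> carrier ?P'" using t g h by (intro P'.m_closed)
    hence "(inv\<^bsub>?P'\<^esub> (t g \<otimes>\<^bsub>?P'\<^esub> t h)) \<beta> = inv\<^bsub>sym_group (m \<beta>)\<^esub> ((t g \<otimes>\<^bsub>?P'\<^esub> t h) \<beta>)" for \<beta>
      by (subst inv_product_group) (auto simp: sym_group_is_group)
    moreover have "(t g \<otimes>\<^bsub>?P'\<^esub> t h) \<beta> = t g \<beta> \<circ> t h \<beta>" for \<beta>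
      by (simp add: sym_group_mult)
    moreover have "t g \<beta> \<circ> t h \<beta> \<in> carrier (sym_group (m \<beta>))" for \<beta>
      using car'[OF g, of \<beta>] car'[OF h, of \<beta>]
      by (auto simp: sym_group_carrier intro: permutes_compose)
    ultimately have eq: "hamming_dist (m \<beta>)
        ((t (g \<otimes>\<^bsub>G\<^esub> h) \<otimes>\<^bsub>?P'\<^esub> inv\<^bsub>?P'\<^esub> (t g \<otimes>\<^bsub>?P'\<^esub> t h)) \<beta>) id
        = (case \<beta> of (F, k) \<Rightarrow> f g h (a F k))" for \<beta>
      by (auto simp: f_def sym_group_mult t_def m_def split: prod.splits)
    have "((\<lambda>\<beta>. case \<beta> of (F, k) \<Rightarrow> f g h (a F k)) \<longlongrightarrow> 0) V"
    proof (rule tendstoI)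
      fix \<epsilon> :: real assume "0 < \<epsilon>"
      then obtain k0 where k0: "inverse (real (Suc k0)) < \<epsilon>"
        using reals_Archimedean by blast
      show "eventually (\<lambda>\<beta>. dist (case \<beta> of (F, k) \<Rightarrow> f g h (a F k)) 0 < \<epsilon>) V"
      proof (rule ev[of "{g, h}" k0])
        fix F k assume F: "finite F" "{g, h} \<subseteq> F" and k: "k0 \<le> (k::nat)"
        have "f g h (a F k) < inverse (real (Suc k))"
          using a[OF F(1), of k] F(2) g h by (auto simp: Good_def)
        also have "\<dots> \<le> inverse (real (Suc k0))"
          using k by (intro le_imp_inverse_le) auto
        also note k0
        finally show "dist (case (F, k) of (F, k) \<Rightarrow> f g h (a F k)) 0 < \<epsilon>"
          by (simp add: f_def hamming_dist_nonneg)
      qed simp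
    qed
    moreover have "t (g \<otimes>\<^bsub>G\<^esub> h) \<otimes>\<^bsub>?P'\<^esub> inv\<^bsub>?P'\<^esub> (t g \<otimes>\<^bsub>?P'\<^esub> t h) \<in> carrier ?P'"
      using t g h by (intro P'.m_closed P'.inv_closed G.m_closed) auto
    ultimately show ?thesis
      using null_sequences_iff[OF V(2),
          where n = m and f = "\<lambda>\<beta>. case \<beta> of (F, k) \<Rightarrow> f g h (a F k)"] eq by blast
  qed
  have t1: "t g \<notin> ?N'" if g: "g \<in> ?C" "g \<noteq> \<one>\<^bsub>G\<^esub>" for g
  proof
    assume "t g \<in> ?N'"
    hence "((\<lambda>\<beta>. hamming_dist (m \<beta>) (t g \<beta>) id) \<longlongrightarrow> 0) V"
      by (simp add: null_sequences_def)
    hence "eventually (\<lambda>\<beta>. hamming_dist (m \<beta>) (t g \<beta>) id < e g) V"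
      by (rule order_tendstoD(2)) (rule e0[OF g])
    moreover have "eventually (\<lambda>\<beta>. e g \<le> hamming_dist (m \<beta>) (t g \<beta>) id) V"
    proof (rule ev[of "{g}" 0])
      fix F k assume "finite F" "{g} \<subseteq> F"
      thus "e g \<le> hamming_dist (m (F, k)) (t g (F, k)) id"
        using a[of F k] g by (auto simp: Good_def d_def m_def t_def)
    qed simp
    ultimately have "eventually (\<lambda>_. False) V" by eventually_elim simp
    thus False using V(2) by (simp add: ultrafilter_on_def trivial_limit_def)
  qed
  have "\<exists>K. subgroup K (?P' Mod ?N') \<and> G \<cong> (?P' Mod ?N')\<lparr>carrier := K\<rparr>"
    unfolding embeds_in_factor_iff[OF G null_sequences_normal[OF V(2)]]
    using t tm t1 by (intro exI[of _ t]) blast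
  hence "sofic_wrt ?B V m G"
    using V(2) n aA by (auto simp: sofic_wrt_def metric_ultraproduct_def m_def)
  thus ?thesis unfolding sofic_def by blast
qed

end

theory Submission
  imports Defs "HOL-Library.Countable_Set"
begin

text \<open>Soficity is equivalent to a finitary condition: every finite set of group elements has almost
  multiplicative, almost free actions on finite sets. Consequently it is a local property, it
  passes to overgroups of finite index, and residually finite groups have it. A non-sofic group
  thus has a finitely generated non-sofic subgroup \<open>H\<close>, and every subgroup of finite index in \<open>H\<close>
  is again finitely generated and non-sofic, hence non-trivial; being locally graded, it has a
  proper subgroup that is normal and of finite index in \<open>H\<close>. Intersecting at each step with the
  next member of an enumeration of the countably many normal subgroups of finite index in \<open>H\<close>
  pushes the chain into the profinite residual. Its intersection is non-trivial, since otherwise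
  \<open>H\<close> would be residually finite and so sofic.\<close>

section \<open>Subgroups of finite index\<close>

context group
begin

text \<open>Any map with finite range whose fibres lie inside single cosets certifies finite index.
  It is applied to pairs of cosets for intersections and to induced maps on cosets for the normal
  core.\<close>

lemma finite_indexI:
  assumes "finite (f ` carrier G)"
    and "\<And>x y. x \<in> carrier G \<Longrightarrow> y \<in> carrier G \<Longrightarrow> f x = f y \<Longrightarrow> L #> x = L #> y"
  shows "finite_index L G"
proof -
  have "L #> x = L #> inv_into (carrier G) f (f x)" if "x \<in> carrier G" for x
    using assms(2)[OF that] that by (metis f_inv_into_f imageI inv_into_into)
  hence "(rcosets L) \<subseteq> (\<lambda>z. L #> inv_into (carrier G) f z) ` f ` carrier G"
    by (auto simp: RCOSETS_def)
  thus ?thesis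
    unfolding finite_index_def using assms(1) by (blast intro: finite_subset)
qed

lemma finite_indexD:
  assumes "finite_index L G"
  shows "finite ((\<lambda>x. L #> x) ` carrier G)"
proof -
  have "(\<lambda>x. L #> x) ` carrier G = rcosets L" by (auto simp: RCOSETS_def)
  thus ?thesis using assms by (simp add: finite_index_def)
qed

lemma finite_index_self: "finite_index (carrier G) G"
  by (rule finite_indexI[where f = "\<lambda>_. ()"])
     (auto simp: coset_join2 subgroup_self)

lemma rcos_Int:
  assumes "subgroup A G" "subgroup B G" "x \<in> carrier G" "y \<in> carrier G"
    and "A #> x = A #> y" "B #> x = B #> y"
  shows "(A \<inter> B) #> x = (A \<inter> B) #> y"
proof -
  have AB: "subgroup (A \<inter> B) G" using assms(1,2) by (rule subgroups_Inter_pair)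
  have "y \<otimes> inv x \<in> A" "y \<otimes> inv x \<in> B"
    using assms by (metis is_group rcos_self subgroup.rcos_module)+
  hence "y \<in> (A \<inter> B) #> x"
    using subgroup.rcos_module[OF AB is_group assms(3,4)] by blast
  thus ?thesis using AB assms(3) by (metis repr_independence)
qed

lemma finite_index_Int:
  assumes "subgroup A G" "subgroup B G" "finite_index A G" "finite_index B G"
  shows "finite_index (A \<inter> B) G"
proof (rule finite_indexI[where f = "\<lambda>x. (A #> x, B #> x)"])
  show "finite ((\<lambda>x. (A #> x, B #> x)) ` carrier G)"
    using assms(3,4)[THEN finite_indexD]
    by (rule_tac finite_subset[of _ "((\<lambda>x. A #> x) ` carrier G) \<times> ((\<lambda>x. B #> x) ` carrier G)"]) auto
next
  show "(A \<inter> B) #> x = (A \<inter> B) #> y"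
    if "x \<in> carrier G" "y \<in> carrier G" "(A #> x, B #> x) = (A #> y, B #> y)" for x y
    using that by (intro rcos_Int assms(1,2)) simp_all
qed

text \<open>Writing \<open>x\<close> as \<open>k \<otimes> t\<close>, where \<open>t\<close> is the
  chosen representative of \<open>K #> x\<close> and \<open>k\<close> lies in \<open>K\<close>,
  shows that \<open>L #> x\<close> is determined by the pair of \<open>L #> k\<close> and
  \<open>K #> x\<close>, for which there are finitely many choices.\<close>

lemma finite_index_trans:
  assumes K: "subgroup K G" and "finite_index K G"
    and L: "subgroup L (G\<lparr>carrier := K\<rparr>)" and "finite_index L (G\<lparr>carrier := K\<rparr>)"
  shows "finite_index L G"
proof -
  define r where "r = (\<lambda>y. SOME x. x \<in> y \<and> x \<in> carrier G)"
  have Lc: "L \<subseteq> carrier G"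
    using subgroup.subset[OF incl_subgroup[OF K L]] .
  have "(rcosets L) \<subseteq> (\<lambda>(c, y). c #> r y) ` ((rcosets\<^bsub>G\<lparr>carrier := K\<rparr>\<^esub> L) \<times> (rcosets K))"
  proof
    fix z assume "z \<in> rcosets L"
    then obtain x where x: "x \<in> carrier G" "z = L #> x" by (auto simp: RCOSETS_def)
    have "\<exists>t. t \<in> K #> x \<and> t \<in> carrier G" using rcos_self[OF x(1) K] x by blast
    hence t: "r (K #> x) \<in> K #> x" "r (K #> x) \<in> carrier G"
      unfolding r_def by (metis (mono_tags, lifting) someI_ex)+
    let ?t = "r (K #> x)"
    have k: "x \<otimes> inv ?t \<in> K"
      using t x K by (metis is_group rcos_self repr_independence subgroup.rcos_module)
    have "z = (L #> (x \<otimes> inv ?t)) #> ?t"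
      using t x Lc by (simp add: coset_mult_assoc m_assoc)
    moreover have "L #> (x \<otimes> inv ?t) \<in> rcosets\<^bsub>G\<lparr>carrier := K\<rparr>\<^esub> L"
      using k by (auto simp: RCOSETS_def r_coset_def)
    ultimately show "z \<in> (\<lambda>(c, y). c #> r y) ` ((rcosets\<^bsub>G\<lparr>carrier := K\<rparr>\<^esub> L) \<times> (rcosets K))"
      using x by (intro image_eqI[of _ _ "(L #> (x \<otimes> inv ?t), K #> x)"]) (auto simp: RCOSETS_def)
  qed
  thus ?thesis
    using assms(2,4) unfolding finite_index_def by (auto intro: finite_subset[OF _ finite_imageI])
qed

lemma rcosets_act_closed:
  assumes "L \<subseteq> carrier G" "y \<in> rcosets L" "h \<in> carrier G"
  shows "y #> h \<in> rcosets L"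
  using assms by (auto simp: RCOSETS_def coset_mult_assoc intro!: exI[of _ "_ \<otimes> _"])

lemma rcosets_act_mult:
  assumes "L \<subseteq> carrier G" "y \<in> rcosets L" "g \<in> carrier G" "h \<in> carrier G"
  shows "y #> (g \<otimes> h) = (y #> g) #> h"
  using assms by (auto simp: RCOSETS_def coset_mult_assoc m_assoc)

text \<open>The normal core of \<open>L\<close> is the kernel of the action of \<open>G\<close> on the cosets of \<open>L\<close>.\<close>

lemma finite_index_core:
  assumes L: "subgroup L G" and fin: "finite_index L G"
  obtains M where "M \<lhd> G" "finite_index M G" "M \<subseteq> L"
proof
  note Lc = subgroup.subset[OF L]
  define M where "M = {h \<in> carrier G. \<forall>y \<in> rcosets L. y #> h = y}"
  have yc: "y \<subseteq> carrier G" if "y \<in> rcosets L" for y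
    using that L by (simp add: subgroup.rcosets_carrier is_group)
  have sub: "subgroup M G"
  proof (rule subgroupI)
    show "M \<subseteq> carrier G" by (auto simp: M_def)
    show "M \<noteq> {}" using yc by (auto simp: M_def intro!: exI[of _ \<one>])
    show "inv h \<in> M" if "h \<in> M" for h
    proof -
      have "y #> inv h = y" if "y \<in> rcosets L" for y
        using that \<open>h \<in> M\<close> yc[OF that] coset_mult_assoc[of y h "inv h"] by (simp add: M_def)
      thus ?thesis using that by (simp add: M_def)
    qed
    show "g \<otimes> h \<in> M" if "g \<in> M" "h \<in> M" for g h
      using that Lc by (simp add: M_def rcosets_act_mult)
  qed
  show "M \<lhd> G"
  proof (rule normal_invI[OF sub])
    fix x h assume x: "x \<in> carrier G" and h: "h \<in> M"
    have hc: "h \<in> carrier G" using h by (simp add: M_def)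
    have "y #> (x \<otimes> h \<otimes> inv x) = y" if y: "y \<in> rcosets L" for y
    proof -
      have "y #> (x \<otimes> h \<otimes> inv x) = ((y #> x) #> h) #> inv x"
        using x hc y Lc by (simp add: rcosets_act_mult rcosets_act_closed)
      also have "(y #> x) #> h = y #> x"
        using h rcosets_act_closed[OF Lc y x] by (simp add: M_def)
      also have "(y #> x) #> inv x = y"
        using x yc[OF y] by (simp add: coset_mult_assoc)
      finally show ?thesis .
    qed
    thus "x \<otimes> h \<otimes> inv x \<in> M" using x hc by (simp add: M_def)
  qed
  show "finite_index M G"
  \<comment> \<open>Restricting to \<open>rcosets L\<close> makes the induced maps extensional, so
    they range over a finite function space. Elements inducing the same map differ by an element of
    the kernel \<open>M\<close>.\<close>
  proof (rule finite_indexI[where f = "\<lambda>x. \<lambda>y\<in>rcosets L. y #> x"])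
    have "(\<lambda>x. \<lambda>y\<in>rcosets L. y #> x) ` carrier G \<subseteq> (rcosets L) \<rightarrow>\<^sub>E (rcosets L)"
      using rcosets_act_closed[OF Lc] by auto
    thus "finite ((\<lambda>x. \<lambda>y\<in>rcosets L. y #> x) ` carrier G)"
      using fin by (meson finite_PiE finite_index_def finite_subset)
  next
    fix x x' assume x: "x \<in> carrier G" "x' \<in> carrier G"
      and eq: "(\<lambda>y\<in>rcosets L. y #> x) = (\<lambda>y\<in>rcosets L. y #> x')"
    have "y #> (x' \<otimes> inv x) = y" if y: "y \<in> rcosets L" for y
    proof -
      have "y #> x' = y #> x" using fun_cong[OF eq, of y] y by simp
      thus ?thesis using x yc[OF y] by (simp add: coset_mult_assoc[symmetric] coset_mult_inv2)
          (simp add: coset_mult_assoc)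
    qed
    hence "x' \<otimes> inv x \<in> M" using x by (simp add: M_def)
    hence "x' \<in> M #> x" using sub x by (simp add: subgroup.rcos_module is_group)
    thus "M #> x = M #> x'" using x(1) sub by (rule repr_independence)
  qed
  show "M \<subseteq> L"
  proof
    fix h assume "h \<in> M"
    \<comment> \<open>An element of \<open>M\<close> fixes in particular the coset \<open>L\<close>,
      whose stabiliser is \<open>L\<close>.\<close>
    moreover have "L \<in> rcosets L"
      using rcosetsI[OF Lc one_closed] Lc by simp
    ultimately show "h \<in> L" using L by (auto simp: M_def intro: coset_join1)
  qed
qed

text \<open>An element outside the intersection is missed by some \<open>N i\<close>. As
  \<open>N i\<close> contains the intersection, the image of \<open>N i\<close> in the quotient
  still misses the image of that element, and it remains normal of finite index.\<close>

lemma residually_finite_quotient: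
  fixes N :: "nat \<Rightarrow> 'a set"
  assumes N: "\<And>i. N i \<lhd> G" "\<And>i. finite_index (N i) G"
  shows "residually_finite (G Mod (\<Inter>i. N i))"
proof -
  let ?R = "\<Inter>i. N i"
  let ?p = "\<lambda>x. ?R #> x"
  have subN: "subgroup (N i) G" for i using N(1) by (rule normal_imp_subgroup)
  have subR: "subgroup ?R G" using subN by (intro subgroups_Inter) auto
  interpret R: normal ?R G
    using subR N(1)[THEN normal_invE(2)] by (intro normal_invI) auto
  interpret Q: group "G Mod ?R" by (rule R.factorgroup_is_group)
  have hom: "group_hom G (G Mod ?R) ?p"
    using R.r_coset_hom_Mod by unfold_locales
  have surj: "?p ` carrier G = carrier (G Mod ?R)"
    by (simp add: carrier_FactGroup)
  show ?thesis unfolding residually_finite_def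
  proof
    fix X assume X: "X \<in> carrier (G Mod ?R) - {\<one>\<^bsub>G Mod ?R\<^esub>}"
    then obtain x where x: "x \<in> carrier G" "X = ?p x" by (auto simp: carrier_FactGroup)
    hence "x \<notin> ?R" using X coset_join2[OF x(1) subR] by auto
    then obtain i where i: "x \<notin> N i" by blast
    have "?p ` N i \<lhd> G Mod ?R"
      by (rule normal.surj_hom_normal_subgroup[OF N(1) hom surj])
    moreover have "finite_index (?p ` N i) (G Mod ?R)"
    proof -
      \<comment> \<open>Each coset of the image of \<open>N i\<close> is the image of a coset of
        \<open>N i\<close>, so the index cannot grow.\<close>
      have "rcosets\<^bsub>G Mod ?R\<^esub> (?p ` N i) \<subseteq> (\<lambda>c. ?p ` c) ` (rcosets (N i))"
      proof
        fix Z assume "Z \<in> rcosets\<^bsub>G Mod ?R\<^esub> (?p ` N i)"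
        then obtain y where y: "y \<in> carrier G" "Z = (?p ` N i) #>\<^bsub>G Mod ?R\<^esub> (?p y)"
          by (auto simp: RCOSETS_def carrier_FactGroup)
        have "Z = ?p ` (N i #> y)"
          using y subgroup.subset[OF subN, of i]
          by (auto simp: r_coset_def[of "G Mod ?R"] r_coset_def[of G "N i"] R.rcos_sum image_iff subset_iff)
        thus "Z \<in> (\<lambda>c. ?p ` c) ` (rcosets (N i))"
          using y(1) subgroup.subset[OF subN] by (auto intro: rcosetsI)
      qed
      thus ?thesis
        using N(2)[of i] unfolding finite_index_def by (rule finite_subset[OF _ finite_imageI])
    qed
    moreover have "X \<notin> ?p ` N i"
    proof
      assume "X \<in> ?p ` N i"
      then obtain n where n: "n \<in> N i" "?p x = ?p n" using x by auto
      hence "x \<in> ?R #> n" using x rcos_self[OF x(1) subR] by simp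
      then obtain r where "r \<in> N i" "x = r \<otimes> n" by (auto simp: r_coset_def)
      thus False using i n(1) subgroup.m_closed[OF subN] by blast
    qed
    ultimately show "\<exists>M. M \<lhd> G Mod ?R \<and> finite_index M (G Mod ?R) \<and> X \<notin> M" by blast
  qed
qed

end

section \<open>Coset transversals, their cocycle and Schreier's lemma\<close>

locale transversal = group G + subgroup L G for G (structure) and L +
  fixes \<sigma> :: "'a set \<Rightarrow> 'a"
  assumes transversal: "y \<in> rcosets L \<Longrightarrow> \<sigma> y \<in> y"
begin

text \<open>\<open>G\<close> acts from the left on the right cosets by \<open>y \<mapsto> y #> inv h\<close>; the cocycle measures
  how far \<open>\<sigma>\<close> is from being equivariant.\<close>

definition cocycle :: "'a \<Rightarrow> 'a set \<Rightarrow> 'a" where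
  "cocycle h y = \<sigma> (y #> inv h) \<otimes> h \<otimes> inv (\<sigma> y)"

lemma act_closed: "y \<in> rcosets L \<Longrightarrow> h \<in> carrier G \<Longrightarrow> y #> inv h \<in> rcosets L"
  by (simp add: rcosets_act_closed subset)

lemma act_mult:
  "y \<in> rcosets L \<Longrightarrow> g \<in> carrier G \<Longrightarrow> h \<in> carrier G \<Longrightarrow>
   y #> inv (g \<otimes> h) = (y #> inv h) #> inv g"
  by (simp add: inv_mult_group rcosets_act_mult[OF subset])

lemma rcoset_subset: "y \<in> rcosets L \<Longrightarrow> y \<subseteq> carrier G"
  by (simp add: rcosets_carrier is_group)

lemma act_one: "y \<in> rcosets L \<Longrightarrow> y #> inv \<one> = y"
  by (simp add: rcoset_subset)

lemma act_inv:
  "y \<in> rcosets L \<Longrightarrow> h \<in> carrier G \<Longrightarrow> (y #> inv h) #> h = y"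
  "y \<in> rcosets L \<Longrightarrow> h \<in> carrier G \<Longrightarrow> (y #> h) #> inv h = y"
  by (simp_all add: rcoset_subset coset_mult_assoc)

lemma representative_closed: "y \<in> rcosets L \<Longrightarrow> \<sigma> y \<in> carrier G"
  using transversal rcoset_subset by blast

lemma rcos_representative:
  assumes "y \<in> rcosets L"
  shows "L #> \<sigma> y = y"
proof -
  obtain x where x: "x \<in> carrier G" "y = L #> x" using assms by (auto simp: RCOSETS_def)
  thus ?thesis using transversal[OF assms] repr_independence[of "\<sigma> y" L x] subgroup_axioms by simp
qed

text \<open>Both \<open>\<sigma> (y #> inv h)\<close> and \<open>\<sigma> y \<otimes> inv h\<close>
  represent the coset \<open>y #> inv h\<close>, so their quotient lies in \<open>L\<close>.\<close>

lemma cocycle_in_subgroup: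
  assumes y: "y \<in> rcosets L" and h: "h \<in> carrier G"
  shows "cocycle h y \<in> L"
proof -
  have s: "\<sigma> y \<in> carrier G" using y by (rule representative_closed)
  have "y #> inv h = L #> (\<sigma> y \<otimes> inv h)"
    using rcos_representative[OF y] coset_mult_assoc[OF subset s, of "inv h"] h by simp
  hence "\<sigma> (y #> inv h) \<in> L #> (\<sigma> y \<otimes> inv h)"
    using transversal[OF act_closed[OF y h]] by simp
  hence "\<sigma> (y #> inv h) \<otimes> inv (\<sigma> y \<otimes> inv h) \<in> L"
    using s h by (intro rcos_module_imp is_group) auto
  thus ?thesis
    using s h representative_closed[OF act_closed[OF y h]]
    by (simp add: cocycle_def inv_mult_group m_assoc)
qed

text \<open>The representative of the intermediate coset \<open>y #> inv h\<close> cancels. This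
  identity reduces words to generators in Schreier's lemma and controls the multiplicativity of
  induced approximations.\<close>

lemma cocycle_mult:
  assumes y: "y \<in> rcosets L" and g: "g \<in> carrier G" and h: "h \<in> carrier G"
  shows "cocycle (g \<otimes> h) y = cocycle g (y #> inv h) \<otimes> cocycle h y"
proof -
  have inv_cancel: "inv a \<otimes> (a \<otimes> b) = b" if "a \<in> carrier G" "b \<in> carrier G" for a b
    using that by (simp add: m_assoc[symmetric])
  have y': "y #> inv h \<in> rcosets L" using y h by (rule act_closed)
  show ?thesis
    using g h representative_closed[OF y] representative_closed[OF y']
      representative_closed[OF act_closed[OF y' g]]
    by (simp add: cocycle_def act_mult[OF y g h] m_assoc inv_cancel)
qed

lemma cocycle_one: "y \<in> rcosets L \<Longrightarrow> cocycle \<one> y = \<one>"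
  using act_one[of y] representative_closed[of y] by (simp add: cocycle_def)

text \<open>At a fixed coset the cocycle is a conjugate of \<open>h\<close>. Hence a non-trivial
  \<open>h\<close> acts on the fibre over a fixed coset through a non-trivial element of
  \<open>L\<close>.\<close>

lemma cocycle_fixed_point:
  assumes y: "y \<in> rcosets L" and h: "h \<in> carrier G" "h \<noteq> \<one>" and fixed: "y #> inv h = y"
  shows "cocycle h y \<noteq> \<one>"
proof
  assume "cocycle h y = \<one>"
  hence "\<sigma> y \<otimes> h \<otimes> inv (\<sigma> y) = \<one>" by (simp add: cocycle_def fixed)
  moreover have "\<sigma> y \<otimes> h = \<sigma> y \<otimes> h \<otimes> inv (\<sigma> y) \<otimes> \<sigma> y"
    using h(1) representative_closed[OF y] by (simp add: m_assoc)
  ultimately show False using h representative_closed[OF y] by simp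
qed

text \<open>Schreier's argument: the cocycle of a word in the generators is a product of cocycles
  of generators, and an element of \<open>L\<close> is conjugate to its cocycle at the coset \<open>L\<close>.\<close>

lemma schreier_generators:
  assumes S: "S \<subseteq> carrier G" "generate G S = carrier G"
  shows "generate G (insert (\<sigma> L) ((\<lambda>(s, y). cocycle s y) ` (S \<times> (rcosets L)))) = L"
    (is "generate G (insert _ ?C) = L")
proof
  have LL: "L \<in> rcosets L" by (rule subgroup_in_rcosets) (rule is_group)
  have C: "insert (\<sigma> L) ?C \<subseteq> L"
    using cocycle_in_subgroup S(1) transversal[OF LL] by auto
  thus "generate G (insert (\<sigma> L) ?C) \<subseteq> L"
    by (rule generate_subgroup_incl) (rule subgroup_axioms)
  let ?D = "generate G (insert (\<sigma> L) ?C)"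
  interpret D: subgroup ?D G
    using C subset by (intro generate_is_subgroup) blast
  have words: "h \<in> carrier G \<and> (\<forall>y\<in>rcosets L. cocycle h y \<in> ?D)" if "h \<in> generate G S" for h
    using that
  proof induction
    case one
    thus ?case by (simp add: cocycle_one)
  next
    case (incl h)
    thus ?case using S(1) by (auto intro!: generate.incl)
  next
    case (inv h)
    hence h: "h \<in> carrier G" using S(1) by blast
    have "cocycle (inv h) y \<in> ?D" if y: "y \<in> rcosets L" for y
    proof -
      have y': "y #> h \<in> rcosets L" using rcosets_act_closed[OF subset y h] .
      \<comment> \<open>Evaluating the cocycle identity for
        \<open>inv h \<otimes> h = \<one>\<close> at \<open>y #> h\<close> exhibits the cocycle of
        \<open>inv h\<close> as the inverse of a generator.\<close>
      have "cocycle (inv h) y \<otimes> cocycle h (y #> h) = \<one>"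
        using cocycle_mult[OF y', of "inv h" h] cocycle_one[OF y'] h y act_inv(2)[OF y h] by simp
      moreover have "cocycle (inv h) y \<in> carrier G" "cocycle h (y #> h) \<in> carrier G"
        using cocycle_in_subgroup y y' h subset by (blast intro: inv_closed)+
      ultimately have "cocycle (inv h) y = inv (cocycle h (y #> h))"
        by (simp add: inv_equality[symmetric])
      moreover have "cocycle h (y #> h) \<in> ?D" using inv.hyps y' by (auto intro!: generate.incl)
      ultimately show ?thesis by simp
    qed
    thus ?case using h by blast
  next
    case (eng g h)
    thus ?case using act_closed by (auto simp: cocycle_mult intro: D.m_closed)
  qed
  show "L \<subseteq> ?D"
  proof
    fix h assume h: "h \<in> L"
    hence hc: "h \<in> carrier G" using subset by blast
    \<comment> \<open>A transversal may choose any element of \<open>L\<close> for the coset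
      \<open>L\<close>, not just \<open>\<one>\<close>. This is why \<open>\<sigma> L\<close>
      belongs to the generating set: it undoes the conjugation below.\<close>
    have \<sigma>: "\<sigma> L \<in> ?D" "\<sigma> L \<in> carrier G"
      using representative_closed[OF LL] by (auto intro: generate.incl)
    have "L #> inv h = L" using h hc by (intro coset_join2 subgroup_axioms) auto
    hence "h = inv (\<sigma> L) \<otimes> cocycle h L \<otimes> \<sigma> L"
      using hc \<sigma>(2) by (simp add: cocycle_def m_assoc[symmetric]) (simp add: m_assoc)
    moreover have "cocycle h L \<in> ?D" using words hc S(2) LL by blast
    ultimately show "h \<in> ?D" using \<sigma>(1) by (metis D.m_closed D.m_inv_closed)
  qed
qed

end

context group
begin

lemma transversal_exists:
  assumes "subgroup L G"
  obtains \<sigma> where "transversal G L \<sigma>"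
proof
  have "(SOME x. x \<in> y) \<in> y" if "y \<in> rcosets L" for y
    using subgroup.rcosets_non_empty[OF assms that] by (simp add: some_in_eq)
  thus "transversal G L (\<lambda>y. SOME x. x \<in> y)"
    using assms by (simp add: transversal_def transversal_axioms_def is_group)
qed

text \<open>Apart from \<open>\<sigma> L\<close>, the Schreier generators are indexed by the finite
  set \<open>S \<times> rcosets L\<close>.\<close>

lemma finitely_generated_finite_index:
  assumes "finitely_generated G" "subgroup L G" "finite_index L G"
  shows "finitely_generated (G\<lparr>carrier := L\<rparr>)"
proof -
  obtain S where S: "finite S" "S \<subseteq> carrier G" "generate G S = carrier G"
    using assms(1) by (auto simp: finitely_generated_def)
  obtain \<sigma> where "transversal G L \<sigma>" using assms(2) by (rule transversal_exists)
  then interpret transversal G L \<sigma> .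
  let ?C = "insert (\<sigma> L) ((\<lambda>(s, y). cocycle s y) ` (S \<times> (rcosets L)))"
  have "finite ?C" using S(1) assms(3) by (simp add: finite_index_def)
  moreover have gen: "generate G ?C = L" using S(2,3) by (rule schreier_generators)
  moreover have "?C \<subseteq> L" using generate.incl[of _ ?C G] gen by blast
  ultimately show ?thesis
    unfolding finitely_generated_def
    by (intro exI[of _ ?C]) (simp add: generate_consistent[OF _ assms(2)])
qed

text \<open>Every generated element is the value of a finite word in \<open>S\<close> and the
  inverses of its elements, concatenation of words giving products. Words over a countable alphabet
  are countable.\<close>

lemma countable_generate:
  assumes "countable S" "S \<subseteq> carrier G"
  shows "countable (generate G S)"
proof -
  let ?w = "foldr (\<lambda>x y. x \<otimes> y)"
  let ?T = "S \<union> (\<lambda>x. inv x) ` S"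
  have T: "?T \<subseteq> carrier G" using assms(2) by auto
  have app: "?w (xs @ ys) \<one> = ?w xs \<one> \<otimes> ?w ys \<one> \<and> ?w xs \<one> \<in> carrier G \<and> ?w ys \<one> \<in> carrier G"
    if "xs \<in> lists ?T" "ys \<in> lists ?T" for xs ys
  proof -
    have cl: "?w zs \<one> \<in> carrier G" if "zs \<in> lists ?T" for zs
      using that T by induction auto
    from that(1) show ?thesis
    proof induction
      case (Cons a l)
      hence "a \<in> carrier G" using T by blast
      with Cons show ?case by (simp add: m_assoc)
    qed (simp add: cl[OF that(2)])
  qed
  have "generate G S \<subseteq> (\<lambda>xs. ?w xs \<one>) ` lists ?T"
  proof
    fix h assume "h \<in> generate G S"
    thus "h \<in> (\<lambda>xs. ?w xs \<one>) ` lists ?T"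
    proof induction
      case one
      show ?case by (rule image_eqI[of _ _ "[]"]) auto
    next
      case (incl h)
      thus ?case using assms(2) by (intro image_eqI[of _ _ "[h]"]) auto
    next
      case (inv h)
      thus ?case using assms(2) by (intro image_eqI[of _ _ "[inv h]"]) auto
    next
      case (eng g h)
      then obtain xs ys where "xs \<in> lists ?T" "ys \<in> lists ?T" "g = ?w xs \<one>" "h = ?w ys \<one>" by blast
      thus ?case using app by (intro image_eqI[of _ _ "xs @ ys"]) auto
    qed
  qed
  moreover have "countable ((\<lambda>xs. ?w xs \<one>) ` lists ?T)"
    using assms(1) by (intro countable_image countable_lists) auto
  ultimately show ?thesis by (rule countable_subset)
qed

text \<open>By Schreier's lemma a subgroup of finite index is generated by a finite subset of the
  countable set \<open>carrier G\<close>.\<close>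

lemma countable_finite_index_subgroups:
  assumes "finitely_generated G"
  shows "countable {L. subgroup L G \<and> finite_index L G}"
proof -
  obtain S where S: "finite S" "S \<subseteq> carrier G" "generate G S = carrier G"
    using assms by (auto simp: finitely_generated_def)
  have "countable (carrier G)"
    using countable_generate[OF countable_finite[OF S(1)] S(2)] S(3) by simp
  hence "countable {T. T \<subseteq> carrier G \<and> finite T}"
    by (simp add: countable_Collect_finite_subset conj_commute)
  hence "countable (generate G ` {T. T \<subseteq> carrier G \<and> finite T})" by (rule countable_image)
  moreover have "L \<in> generate G ` {T. T \<subseteq> carrier G \<and> finite T}"
    if L: "subgroup L G" "finite_index L G" for L
  proof -
    obtain T where "finite T" "T \<subseteq> L" "generate (G\<lparr>carrier := L\<rparr>) T = L"
      using finitely_generated_finite_index[OF assms L] by (auto simp: finitely_generated_def)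
    thus ?thesis
      using generate_consistent[OF _ L(1)] subgroup.subset[OF L(1)] by (intro image_eqI[of _ _ T]) auto
  qed
  ultimately show ?thesis by (blast intro: countable_subset)
qed

end

section \<open>Soficity by finite approximations\<close>

text \<open>The finite set \<open>X\<close> is arbitrary so that tuples, cosets, and pairs of a
  coset and a point can be used without numbering them. Bijections are demanded on all of
  \<open>carrier G\<close>, because products may leave \<open>F\<close> and an ultraproduct needs a
  permutation for every group element. The bound \<open>c\<close> is kept variable because a given
  embedding only yields some constant below 1, which has to be improved to
  \<open>1 / 2\<close>.\<close>

definition approx_rep ::
    "('a, 'b) monoid_scheme \<Rightarrow> 'a set \<Rightarrow> real \<Rightarrow> real \<Rightarrow> 'x set \<Rightarrow> ('a \<Rightarrow> 'x \<Rightarrow> 'x) \<Rightarrow> bool" where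
  "approx_rep G F \<epsilon> c X s \<longleftrightarrow> finite X \<and> X \<noteq> {} \<and>
     (\<forall>g\<in>carrier G. bij_betw (s g) X X) \<and>
     (\<forall>g\<in>F. \<forall>h\<in>F. (1 - \<epsilon>) * real (card X) \<le> real (card {x\<in>X. s (g \<otimes>\<^bsub>G\<^esub> h) x = s g (s h x)})) \<and>
     (\<forall>g\<in>F. g \<noteq> \<one>\<^bsub>G\<^esub> \<longrightarrow> real (card {x\<in>X. s g x = x}) \<le> c * real (card X))"

lemma approx_rep_mono:
  assumes "approx_rep G F \<epsilon> c X s" "\<epsilon> \<le> \<epsilon>'" "c \<le> c'"
  shows "approx_rep G F \<epsilon>' c' X s"
proof -
  have "(1 - \<epsilon>') * real (card X) \<le> (1 - \<epsilon>) * real (card X)" "c * real (card X) \<le> c' * real (card X)"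
    using assms(2,3) by (auto intro: mult_right_mono)
  thus ?thesis using assms(1) unfolding approx_rep_def by (meson order_trans)
qed

text \<open>The action is conjugated by \<open>b\<close>. Being the identity outside
  \<open>Y\<close> is what \<open>permutes\<close> requires once \<open>Y\<close> is an interval of
  numbers.\<close>

lemma approx_rep_bij_image:
  assumes G: "group G" and F: "F \<subseteq> carrier G"
    and s: "approx_rep G F \<epsilon> c X s" and b: "bij_betw b X Y"
  shows "approx_rep G F \<epsilon> c Y (\<lambda>g y. if y \<in> Y then b (s g (inv_into X b y)) else y)"
proof -
  define t where "t = (\<lambda>g y. if y \<in> Y then b (s g (inv_into X b y)) else y)"
  interpret G: group G by (rule G)
  let ?i = "inv_into X b"
  have bij: "bij_betw (s g) X X" if "g \<in> carrier G" for g using s that by (simp add: approx_rep_def)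
  have inj: "inj_on b X" using b by (simp add: bij_betw_def)
  have ib: "?i (b x) = x" if "x \<in> X" for x using inj that by simp
  have bX: "b x \<in> Y" if "x \<in> X" for x using b that by (auto simp: bij_betw_def)
  have sX: "s g x \<in> X" if "g \<in> carrier G" "x \<in> X" for g x using bij[OF that(1)] that(2) by (auto simp: bij_betw_def)
  have t: "t g (b x) = b (s g x)" if "x \<in> X" for g x using that by (simp add: t_def ib bX)
  have card: "card {y\<in>Y. P y} = card {x\<in>X. P (b x)}" for P
  proof -
    have "{y\<in>Y. P y} = b ` {x\<in>X. P (b x)}" using b by (auto simp: bij_betw_def)
    thus ?thesis using inj by (simp add: card_image inj_on_subset)
  qed
  have eq: "b x = b y \<longleftrightarrow> x = y" if "x \<in> X" "y \<in> X" for x y using inj that by (auto dest: inj_onD)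
  have fixed: "{x\<in>X. t g (b x) = b x} = {x\<in>X. s g x = x}" if "g \<in> carrier G" for g
    using that by (auto simp: t eq sX)
  have agree: "{x\<in>X. t (g \<otimes>\<^bsub>G\<^esub> h) (b x) = t g (t h (b x))}
      = {x\<in>X. s (g \<otimes>\<^bsub>G\<^esub> h) x = s g (s h x)}"
    if "g \<in> carrier G" "h \<in> carrier G" for g h
    using that by (intro Collect_cong conj_cong refl) (simp only: t sX eq G.m_closed)
  have bijt: "bij_betw (t g) Y Y" if "g \<in> carrier G" for g
  proof -
    have "bij_betw (b \<circ> (s g \<circ> ?i)) Y Y"
      using b bij[OF that] bij_betw_inv_into[OF b] by (blast intro: bij_betw_trans)
    thus ?thesis by (rule iffD1[OF bij_betw_cong, rotated]) (simp add: t_def)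
  qed
  have "finite Y" "Y \<noteq> {}" "card Y = card X"
    using s b bij_betw_finite[OF b] bij_betw_same_card[OF b] bij_betw_empty1
    by (auto simp: approx_rep_def bij_betw_def)
  thus ?thesis
    using s F bijt unfolding approx_rep_def card t_def[symmetric]
    by (auto simp: agree fixed subset_iff)
qed

lemma approx_rep_permutes:
  assumes "group G" "F \<subseteq> carrier G" "approx_rep G F \<epsilon> c X s"
  obtains n t where "0 < n" "approx_rep G F \<epsilon> c {1..n::nat} t"
    "\<And>g. g \<in> carrier G \<Longrightarrow> t g permutes {1..n}"
proof -
  have X: "finite X" "X \<noteq> {}" using assms(3) by (auto simp: approx_rep_def)
  then obtain b where b: "bij_betw b X {1..card X}"
    using ex_bij_betw_finite_nat ex_bij_betw_nat_finite_1 by (metis bij_betw_inv)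
  let ?t = "\<lambda>g y. if y \<in> {1..card X} then b (s g (inv_into X b y)) else y"
  have t: "approx_rep G F \<epsilon> c {1..card X} ?t" by (rule approx_rep_bij_image[OF assms b])
  moreover have "?t g permutes {1..card X}" if "g \<in> carrier G" for g
    using t that by (intro bij_imp_permutes) (auto simp: approx_rep_def)
  moreover have "0 < card X" using X by (simp add: card_gt_0_iff)
  ultimately show thesis using that by blast
qed

text \<open>The diagonal action on \<open>k\<close>-tuples makes the proportion of fixed points exponentially
  small while the error grows only linearly.\<close>

lemma approx_rep_power:
  fixes X :: "'x set"
  assumes s: "approx_rep G F \<epsilon> c X s" and \<epsilon>: "\<epsilon> \<le> 1" and c: "0 \<le> c"
  shows "approx_rep G F (real k * \<epsilon>) (c ^ k) ({..<k} \<rightarrow>\<^sub>E X) (\<lambda>g f. \<lambda>i\<in>{..<k}. s g (f i))"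
    (is "approx_rep G F _ _ ?Y ?t")
proof -
  have fin: "finite X" "X \<noteq> {}" and bij: "\<And>g. g \<in> carrier G \<Longrightarrow> bij_betw (s g) X X"
    using s by (auto simp: approx_rep_def)
  have cardY: "card ?Y = card X ^ k" by (simp add: card_PiE)
  have card: "card {f\<in>?Y. \<forall>i<k. P (f i)} = card {x\<in>X. P x} ^ k" for P
  proof -
    have "{f\<in>?Y. \<forall>i<k. P (f i)} = {..<k} \<rightarrow>\<^sub>E {x\<in>X. P x}"
      by (rule Set.set_eqI) (simp add: PiE_iff, blast)
    thus ?thesis by (simp add: card_PiE)
  qed
  have eq: "restrict u {..<k} = restrict v {..<k} \<longleftrightarrow> (\<forall>i<k. u i = v i)" for u v :: "nat \<Rightarrow> 'x"
    by (metis lessThan_iff restrict_apply' restrict_ext)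
  have bijt: "bij_betw (?t g) ?Y ?Y" if g: "g \<in> carrier G" for g
  proof (rule bij_betwI[where g = "\<lambda>f. \<lambda>i\<in>{..<k}. inv_into X (s g) (f i)"])
    note b = bij[OF g]
    show "?t g \<in> ?Y \<rightarrow> ?Y" using bij_betwE[OF b] by auto
    show "(\<lambda>f. \<lambda>i\<in>{..<k}. inv_into X (s g) (f i)) \<in> ?Y \<rightarrow> ?Y"
      using bij_betwE[OF bij_betw_inv_into[OF b]] by auto
    show "(\<lambda>i\<in>{..<k}. inv_into X (s g) (?t g f i)) = f" if "f \<in> ?Y" for f
      using that bij_betw_inv_into_left[OF b] by (intro ext) (auto simp: PiE_iff extensional_def)
    show "?t g (\<lambda>i\<in>{..<k}. inv_into X (s g) (f i)) = f" if "f \<in> ?Y" for f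
      using that bij_betw_inv_into_right[OF b] by (intro ext) (auto simp: PiE_iff extensional_def)
  qed
  have agree: "(1 - real k * \<epsilon>) * real (card ?Y) \<le> real (card {f\<in>?Y. ?t (g \<otimes>\<^bsub>G\<^esub> h) f = ?t g (?t h f)})"
    if "g \<in> F" "h \<in> F" for g h
  proof -
    \<comment> \<open>Two tuples agree iff all coordinates do, which costs a factor
      \<open>(1 - \<epsilon>) ^ k\<close>. Bernoulli's inequality makes this linear in
      \<open>k\<close>; its side condition is \<open>\<epsilon> \<le> 1\<close>.\<close>
    have "1 + real k * (- \<epsilon>) \<le> (1 + (- \<epsilon>)) ^ k" using \<epsilon> by (intro Bernoulli_inequality) simp
    hence "(1 - real k * \<epsilon>) * real (card ?Y) \<le> (1 - \<epsilon>) ^ k * real (card ?Y)" by (intro mult_right_mono) auto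
    also have "\<dots> = ((1 - \<epsilon>) * real (card X)) ^ k" by (simp add: cardY power_mult_distrib)
    also have "\<dots> \<le> real (card {x\<in>X. s (g \<otimes>\<^bsub>G\<^esub> h) x = s g (s h x)}) ^ k"
      using s that \<epsilon> by (intro power_mono) (auto simp: approx_rep_def)
    also have "\<dots> = real (card {f\<in>?Y. ?t (g \<otimes>\<^bsub>G\<^esub> h) f = ?t g (?t h f)})"
      using card[of "\<lambda>x. s (g \<otimes>\<^bsub>G\<^esub> h) x = s g (s h x)"] by (simp add: eq cong: restrict_cong)
    finally show ?thesis .
  qed
  have fixed: "real (card {f\<in>?Y. ?t g f = f}) \<le> c ^ k * real (card ?Y)" if "g \<in> F" "g \<noteq> \<one>\<^bsub>G\<^esub>" for g
  proof -
    have "?t g f = f \<longleftrightarrow> (\<forall>i<k. s g (f i) = f i)" if "f \<in> ?Y" for f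
      using that eq[of "\<lambda>i. s g (f i)" f] by (simp add: PiE_restrict)
    hence "{f\<in>?Y. ?t g f = f} = {f\<in>?Y. \<forall>i<k. s g (f i) = f i}" by blast
    hence "real (card {f\<in>?Y. ?t g f = f}) = real (card {x\<in>X. s g x = x}) ^ k"
      using card[of "\<lambda>x. s g x = x"] by simp
    also have "\<dots> \<le> (c * real (card X)) ^ k"
      using s that by (intro power_mono) (auto simp: approx_rep_def)
    finally show ?thesis by (simp add: cardY power_mult_distrib)
  qed
  show ?thesis
    using fin bijt agree fixed unfolding approx_rep_def
    by (intro conjI ballI impI) (auto simp: finite_PiE PiE_eq_empty_iff)
qed

section \<open>From Hamming distances in ultraproducts to finite approximations and back\<close>

lemma card_agree_hamming_dist:
  assumes "0 < n"
  shows "real (card {i\<in>{1..n}. \<sigma> i = \<tau> i}) = (1 - hamming_dist n \<sigma> \<tau>) * real n"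
proof -
  let ?A = "{i\<in>{1..n}. \<sigma> i = \<tau> i}" and ?B = "{i\<in>{1..n}. \<sigma> i \<noteq> \<tau> i}"
  have "card ?A + card ?B = card (?A \<union> ?B)" by (rule card_Un_disjoint[symmetric]) auto
  also have "?A \<union> ?B = {1..n}" by blast
  finally have "real (card ?A) + real (card ?B) = real n" by (simp flip: of_nat_add)
  thus ?thesis using assms by (simp add: hamming_dist_def left_diff_distrib)
qed

text \<open>This is right invariance of the Hamming metric: reindexing by \<open>\<tau>\<close>
  carries the points of disagreement to the points moved by the quotient.\<close>

lemma hamming_dist_comp_inv:
  assumes "\<tau> permutes {1..n}"
  shows "hamming_dist n (\<sigma> \<circ> inv' \<tau>) id = hamming_dist n \<sigma> \<tau>"
proof -
  have "bij_betw \<tau> {i\<in>{1..n}. \<sigma> i \<noteq> \<tau> i} {i\<in>{1..n}. (\<sigma> \<circ> inv' \<tau>) i \<noteq> id i}"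
  proof (rule bij_betwI[where g = "inv' \<tau>"])
    show "\<tau> \<in> {i\<in>{1..n}. \<sigma> i \<noteq> \<tau> i} \<rightarrow> {i\<in>{1..n}. (\<sigma> \<circ> inv' \<tau>) i \<noteq> id i}"
      using permutes_in_image[OF assms] permutes_inverses[OF assms]
      by (auto simp del: atLeastAtMost_iff)
    show "inv' \<tau> \<in> {i\<in>{1..n}. (\<sigma> \<circ> inv' \<tau>) i \<noteq> id i} \<rightarrow> {i\<in>{1..n}. \<sigma> i \<noteq> \<tau> i}"
      using permutes_in_image[OF permutes_inv[OF assms]] permutes_inverses[OF assms]
      by (auto simp del: atLeastAtMost_iff)
  qed (simp_all add: permutes_inverses[OF assms])
  from bij_betw_same_card[OF this] show ?thesis by (simp add: hamming_dist_def)
qed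

text \<open>The criterion \<open>embeds_in_factor_iff\<close> measures failure of multiplicativity
  by a quotient in the product group; read at one coordinate, its size becomes a distance between
  permutations.\<close>

lemma defect_hamming_dist:
  assumes \<sigma>: "\<And>g. g \<in> {u, v, w} \<Longrightarrow> g \<in> carrier (product_group A (\<lambda>\<alpha>. sym_group (n \<alpha>)))"
    and \<alpha>: "\<alpha> \<in> A"
  shows "hamming_dist (n \<alpha>) ((w \<otimes>\<^bsub>product_group A (\<lambda>\<alpha>. sym_group (n \<alpha>))\<^esub>
      inv\<^bsub>product_group A (\<lambda>\<alpha>. sym_group (n \<alpha>))\<^esub> (u \<otimes>\<^bsub>product_group A (\<lambda>\<alpha>. sym_group (n \<alpha>))\<^esub> v)) \<alpha>) id
      = hamming_dist (n \<alpha>) (w \<alpha>) (u \<alpha> \<circ> v \<alpha>)"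
proof -
  let ?P = "product_group A (\<lambda>\<alpha>. sym_group (n \<alpha>))"
  interpret P: group ?P by (rule group_product_sym)
  have car: "g \<alpha> permutes {1..n \<alpha>}" if "g \<in> {u, v, w}" for g
    using \<sigma>[OF that] \<alpha> by (auto simp: PiE_iff sym_group_carrier)
  hence uv: "u \<alpha> \<circ> v \<alpha> permutes {1..n \<alpha>}" by (auto intro: permutes_compose)
  have "u \<otimes>\<^bsub>?P\<^esub> v \<in> carrier ?P" using \<sigma> by (intro P.m_closed) auto
  hence "(inv\<^bsub>?P\<^esub> (u \<otimes>\<^bsub>?P\<^esub> v)) \<alpha> = inv\<^bsub>sym_group (n \<alpha>)\<^esub> ((u \<otimes>\<^bsub>?P\<^esub> v) \<alpha>)"
    using \<alpha> by (subst inv_product_group) (auto simp: sym_group_is_group)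
  moreover have "(u \<otimes>\<^bsub>?P\<^esub> v) \<alpha> = u \<alpha> \<circ> v \<alpha>"
    using \<alpha> by (simp add: sym_group_mult)
  ultimately show ?thesis
    using \<alpha> uv by (simp add: sym_group_mult sym_group_carrier hamming_dist_comp_inv)
qed

text \<open>On an ultrafilter-large set of indices a lifted embedding is almost multiplicative on
  \<open>F\<close> and moves a fixed positive proportion of points for each non-trivial element. One
  such index, followed by a power of the action, gives the bound \<open>1 / 2\<close>.\<close>

lemma sofic_imp_approx_rep:
  fixes G :: "('a, 'b) monoid_scheme"
  assumes G: "group G" and sof: "sofic G"
    and F: "finite F" "F \<subseteq> carrier G" and \<epsilon>: "0 < \<epsilon>"
  obtains n t where "approx_rep G F \<epsilon> (1 / 2) {1..n::nat} t"
proof -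
  interpret G: group G by (rule G)
  obtain A U and n :: "'a set \<times> nat \<Rightarrow> nat" where U: "ultrafilter_on A U"
    and n: "\<And>\<alpha>. \<alpha> \<in> A \<Longrightarrow> 0 < n \<alpha>"
    and emb: "\<exists>K. subgroup K (product_group A (\<lambda>\<alpha>. sym_group (n \<alpha>)) Mod null_sequences A U n) \<and>
      G \<cong> (product_group A (\<lambda>\<alpha>. sym_group (n \<alpha>)) Mod null_sequences A U n)\<lparr>carrier := K\<rparr>"
    using sof by (auto simp: sofic_def sofic_wrt_def metric_ultraproduct_def)
  let ?P = "product_group A (\<lambda>\<alpha>. sym_group (n \<alpha>))"
  let ?N = "null_sequences A U n"
  interpret P: group ?P by (rule group_product_sym)
  obtain s where s: "\<And>g. g \<in> carrier G \<Longrightarrow> s g \<in> carrier ?P"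
    and sm: "\<And>g h. g \<in> carrier G \<Longrightarrow> h \<in> carrier G \<Longrightarrow>
               s (g \<otimes>\<^bsub>G\<^esub> h) \<otimes>\<^bsub>?P\<^esub> inv\<^bsub>?P\<^esub> (s g \<otimes>\<^bsub>?P\<^esub> s h) \<in> ?N"
    and s1: "\<And>g. g \<in> carrier G \<Longrightarrow> g \<noteq> \<one>\<^bsub>G\<^esub> \<Longrightarrow> s g \<notin> ?N"
    using emb unfolding embeds_in_factor_iff[OF G null_sequences_normal[OF U]]
    by (blast dest: funcset_mem)
  have defect: "((\<lambda>\<alpha>. hamming_dist (n \<alpha>) (s (g \<otimes>\<^bsub>G\<^esub> h) \<alpha>) (s g \<alpha> \<circ> s h \<alpha>)) \<longlongrightarrow> 0) U"
    if "g \<in> carrier G" "h \<in> carrier G" for g h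
  proof -
    have "s (g \<otimes>\<^bsub>G\<^esub> h) \<otimes>\<^bsub>?P\<^esub> inv\<^bsub>?P\<^esub> (s g \<otimes>\<^bsub>?P\<^esub> s h) \<in> carrier ?P"
      using sm[OF that] by (simp add: null_sequences_def)
    hence "s (g \<otimes>\<^bsub>G\<^esub> h) \<otimes>\<^bsub>?P\<^esub> inv\<^bsub>?P\<^esub> (s g \<otimes>\<^bsub>?P\<^esub> s h) \<in> ?N \<longleftrightarrow> ?thesis"
      by (rule null_sequences_iff[OF U _ defect_hamming_dist]) (use s that G.m_closed in blast)
    thus ?thesis using sm[OF that] by blast
  qed
  have "\<exists>e>0. eventually (\<lambda>\<alpha>. e \<le> hamming_dist (n \<alpha>) (s g \<alpha>) id) U"
    if g: "g \<in> carrier G" "g \<noteq> \<one>\<^bsub>G\<^esub>" for g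
  proof -
    have "\<not> ((\<lambda>\<alpha>. hamming_dist (n \<alpha>) (s g \<alpha>) id) \<longlongrightarrow> 0) U"
      using s1[OF g] s[OF g(1)] by (simp add: null_sequences_def)
    then obtain e where e: "e > 0" "\<not> eventually (\<lambda>\<alpha>. dist (hamming_dist (n \<alpha>) (s g \<alpha>) id) 0 < e) U"
      by (auto simp: tendsto_iff)
    \<comment> \<open>Here the ultrafilter is essential: it turns "not eventually" into "eventually
      not".\<close>
    have "eventually (\<lambda>\<alpha>. \<not> dist (hamming_dist (n \<alpha>) (s g \<alpha>) id) 0 < e) U"
      using U e(2) unfolding ultrafilter_on_def by blast
    hence "eventually (\<lambda>\<alpha>. e \<le> hamming_dist (n \<alpha>) (s g \<alpha>) id) U"
      by eventually_elim (simp add: hamming_dist_nonneg not_less)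
    thus ?thesis using e(1) by blast
  qed
  then obtain e where e0: "\<And>g. g \<in> carrier G \<Longrightarrow> g \<noteq> \<one>\<^bsub>G\<^esub> \<Longrightarrow> 0 < e g"
    and e: "\<And>g. g \<in> carrier G \<Longrightarrow> g \<noteq> \<one>\<^bsub>G\<^esub> \<Longrightarrow>
      eventually (\<lambda>\<alpha>. e g \<le> hamming_dist (n \<alpha>) (s g \<alpha>) id) U"
    by metis
  \<comment> \<open>Inserting 1 covers the case that \<open>F\<close> has no non-trivial element and
    keeps \<open>1 - \<delta>\<close> non-negative.\<close>
  define \<delta> where "\<delta> = Min (insert 1 (e ` (F - {\<one>\<^bsub>G\<^esub>})))"
  have \<delta>: "0 < \<delta>" "\<delta> \<le> 1" "\<And>g. g \<in> F \<Longrightarrow> g \<noteq> \<one>\<^bsub>G\<^esub> \<Longrightarrow> \<delta> \<le> e g"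
    using F e0 by (auto simp: \<delta>_def subset_iff)
  obtain k where k: "(1 - \<delta>) ^ k < 1 / 2"
    using real_arch_pow_inv[of "1 / 2" "1 - \<delta>"] \<delta> by auto
  \<comment> \<open>Taking powers multiplies the error by \<open>k\<close>, so it is divided out in
    advance; the cap at 1 provides the hypothesis of \<open>approx_rep_power\<close>.\<close>
  define \<epsilon>' where "\<epsilon>' = min 1 (\<epsilon> / real (Suc k))"
  have \<epsilon>': "0 < \<epsilon>'" "\<epsilon>' \<le> 1" "real k * \<epsilon>' \<le> \<epsilon>"
  proof -
    have "real k * \<epsilon>' \<le> real (Suc k) * (\<epsilon> / real (Suc k))"
      using \<epsilon> by (intro mult_mono) (auto simp: \<epsilon>'_def)
    thus "real k * \<epsilon>' \<le> \<epsilon>" by simp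
  qed (use \<epsilon> in \<open>auto simp: \<epsilon>'_def\<close>)
  have "eventually (\<lambda>\<alpha>. hamming_dist (n \<alpha>) (s (g \<otimes>\<^bsub>G\<^esub> h) \<alpha>) (s g \<alpha> \<circ> s h \<alpha>) < \<epsilon>') U"
    if "g \<in> F" "h \<in> F" for g h
    using that F \<epsilon>' by (intro order_tendstoD(2)[OF defect]) auto
  hence "eventually (\<lambda>\<alpha>. \<alpha> \<in> A \<and>
      (\<forall>g\<in>F. \<forall>h\<in>F. hamming_dist (n \<alpha>) (s (g \<otimes>\<^bsub>G\<^esub> h) \<alpha>) (s g \<alpha> \<circ> s h \<alpha>) < \<epsilon>') \<and>
      (\<forall>g\<in>F - {\<one>\<^bsub>G\<^esub>}. e g \<le> hamming_dist (n \<alpha>) (s g \<alpha>) id)) U" (is "eventually ?good U")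
    using F e eventually_ultrafilter_on[OF U]
    by (intro eventually_conj eventually_ball_finite ballI) auto
  moreover have "U \<noteq> bot" using U by (simp add: ultrafilter_on_def)
  ultimately obtain \<alpha> where "?good \<alpha>" by (blast dest: eventually_happens')
  hence \<alpha>: "\<alpha> \<in> A"
    and d1: "\<And>g h. g \<in> F \<Longrightarrow> h \<in> F \<Longrightarrow>
      hamming_dist (n \<alpha>) (s (g \<otimes>\<^bsub>G\<^esub> h) \<alpha>) (s g \<alpha> \<circ> s h \<alpha>) < \<epsilon>'"
    and d2: "\<And>g. g \<in> F \<Longrightarrow> g \<noteq> \<one>\<^bsub>G\<^esub> \<Longrightarrow> e g \<le> hamming_dist (n \<alpha>) (s g \<alpha>) id"
    by auto
  have perm: "s g \<alpha> permutes {1..n \<alpha>}" if "g \<in> carrier G" for g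
    using s[OF that] \<alpha> by (auto simp: PiE_iff sym_group_carrier)
  have "approx_rep G F \<epsilon>' (1 - \<delta>) {1..n \<alpha>} (\<lambda>g. s g \<alpha>)"
    unfolding approx_rep_def
  proof (intro conjI ballI impI)
    show "{1..n \<alpha>} \<noteq> {}" using n[OF \<alpha>] by simp
    show "bij_betw (s g \<alpha>) {1..n \<alpha>} {1..n \<alpha>}" if "g \<in> carrier G" for g
      using perm[OF that] by (rule permutes_imp_bij)
    show "(1 - \<epsilon>') * real (card {1..n \<alpha>}) \<le> real (card {x\<in>{1..n \<alpha>}. s (g \<otimes>\<^bsub>G\<^esub> h) \<alpha> x = s g \<alpha> (s h \<alpha> x)})"
      if "g \<in> F" "h \<in> F" for g h
      using card_agree_hamming_dist[OF n[OF \<alpha>], of "s (g \<otimes>\<^bsub>G\<^esub> h) \<alpha>" "s g \<alpha> \<circ> s h \<alpha>"] d1[OF that]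
      by (simp add: mult_right_mono)
    show "real (card {x\<in>{1..n \<alpha>}. s g \<alpha> x = x}) \<le> (1 - \<delta>) * real (card {1..n \<alpha>})"
      if "g \<in> F" "g \<noteq> \<one>\<^bsub>G\<^esub>" for g
      using card_agree_hamming_dist[OF n[OF \<alpha>], of "s g \<alpha>" id] d2[OF that] \<delta>(3)[OF that]
      by (simp add: mult_right_mono)
  qed simp
  hence "approx_rep G F (real k * \<epsilon>') ((1 - \<delta>) ^ k) ({..<k} \<rightarrow>\<^sub>E {1..n \<alpha>}) (\<lambda>g f. \<lambda>i\<in>{..<k}. s g \<alpha> (f i))"
    using \<epsilon>' \<delta> by (intro approx_rep_power) auto
  hence "approx_rep G F \<epsilon> (1 / 2) ({..<k} \<rightarrow>\<^sub>E {1..n \<alpha>}) (\<lambda>g f. \<lambda>i\<in>{..<k}. s g \<alpha> (f i))"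
    by (rule approx_rep_mono) (use \<epsilon>' k in auto)
  from approx_rep_permutes[OF G F(2) this] that show thesis by blast
qed

text \<open>Coordinates are pairs \<open>(F, k)\<close>, with an approximation on \<open>F\<close>
  up to \<open>1 / (k + 1)\<close>. Along an ultrafilter containing all large pairs the defects tend
  to 0, while every non-trivial element stays at distance at least \<open>1 / 2\<close> from the
  identity.\<close>

lemma approx_rep_imp_sofic:
  fixes G :: "('a, 'b) monoid_scheme"
  assumes G: "group G"
    and approx: "\<And>F \<epsilon>. finite F \<Longrightarrow> F \<subseteq> carrier G \<Longrightarrow> 0 < \<epsilon> \<Longrightarrow>
      \<exists>(X :: 'x set) s. approx_rep G F \<epsilon> (1 / 2) X s"
  shows "sofic G"
proof -
  interpret G: group G by (rule G)
  \<comment> \<open>Every subset must serve as an index, so infinite ones are given the empty set to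
    approximate on.\<close>
  let ?F = "\<lambda>F. if finite F then F \<inter> carrier G else {}"
  have "\<exists>n t. 0 < n \<and> approx_rep G (?F F) (inverse (real (Suc k))) (1 / 2) {1..n::nat} t \<and>
      (\<forall>g\<in>carrier G. t g permutes {1..n})" for F k
  proof -
    have F: "?F F \<subseteq> carrier G" by simp
    have "\<exists>(X :: 'x set) s. approx_rep G (?F F) (inverse (real (Suc k))) (1 / 2) X s"
      by (rule approx[OF _ F]) simp_all
    then obtain X :: "'x set" and s where "approx_rep G (?F F) (inverse (real (Suc k))) (1 / 2) X s"
      by blast
    from approx_rep_permutes[OF G F this] show ?thesis by metis
  qed
  then obtain n0 t0 where n0: "\<And>F k. 0 < n0 F k"
    and t0: "\<And>F k. approx_rep G (?F F) (inverse (real (Suc k))) (1 / 2) {1..n0 F k::nat} (t0 F k)"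
    and perm0: "\<And>F k g. g \<in> carrier G \<Longrightarrow> t0 F k g permutes {1..n0 F k}"
    by metis
  define n where "n = (\<lambda>\<beta>. n0 (fst \<beta>) (snd \<beta>))"
  define t where "t = (\<lambda>g \<beta>. t0 (fst \<beta>) (snd \<beta>) g)"
  have perm: "t g \<beta> permutes {1..n \<beta>}" if "g \<in> carrier G" for g \<beta>
    using perm0[OF that] by (simp add: t_def n_def)
  have n: "0 < n \<beta>" for \<beta> by (simp add: n_def n0)
  let ?B = "UNIV :: ('a set \<times> nat) set"
  \<comment> \<open>In this filter both \<open>F\<close> and \<open>k\<close> grow;
    \<open>ev\<close> records that whatever holds for all sufficiently large pairs holds eventually
    in the refining ultrafilter.\<close>
  let ?U = "finite_subsets_at_top (UNIV :: 'a set) \<times>\<^sub>F (sequentially :: nat filter)"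
  have "?U \<noteq> bot" by (simp add: prod_filter_eq_bot)
  then obtain V where V: "V \<le> ?U" "ultrafilter_on ?B V"
    using ultrafilter_exists by blast
  have ev: "eventually Q V" if "finite F" "\<And>F' k'. finite F' \<Longrightarrow> F \<subseteq> F' \<Longrightarrow> k \<le> k' \<Longrightarrow> Q (F', k')"
    for F k Q
  proof (rule filter_leD[OF V(1)])
    have "eventually (\<lambda>F'. finite F' \<and> F \<subseteq> F') (finite_subsets_at_top UNIV)"
      using \<open>finite F\<close> by (auto simp: eventually_finite_subsets_at_top)
    thus "eventually Q ?U"
      unfolding eventually_prod_filter
      using that(2) eventually_ge_at_top[of k] by blast
  qed
  have defect: "hamming_dist (n (F, k)) (t (g \<otimes>\<^bsub>G\<^esub> h) (F, k)) (t g (F, k) \<circ> t h (F, k)) \<le> inverse (real (Suc k))"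
    if "finite F" "{g, h} \<subseteq> F" "g \<in> carrier G" "h \<in> carrier G" for g h F k
  proof -
    have "(1 - inverse (real (Suc k))) * real (n (F, k))
        \<le> real (card {i\<in>{1..n (F, k)}. t (g \<otimes>\<^bsub>G\<^esub> h) (F, k) i = (t g (F, k) \<circ> t h (F, k)) i})"
      using t0[of F k] that by (simp add: approx_rep_def n_def t_def)
    also have "\<dots> = (1 - hamming_dist (n (F, k)) (t (g \<otimes>\<^bsub>G\<^esub> h) (F, k)) (t g (F, k) \<circ> t h (F, k))) * real (n (F, k))"
      by (rule card_agree_hamming_dist) (rule n)
    finally show ?thesis using n[of "(F, k)"] by (simp add: mult_le_cancel_right)
  qed
  have separated: "1 / 2 \<le> hamming_dist (n (F, k)) (t g (F, k)) id"
    if "finite F" "g \<in> F" "g \<in> carrier G" "g \<noteq> \<one>\<^bsub>G\<^esub>" for g F k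
  proof -
    have "real (card {i\<in>{1..n (F, k)}. t g (F, k) i = id i}) \<le> 1 / 2 * real (n (F, k))"
      using t0[of F k] that by (simp add: approx_rep_def n_def t_def)
    hence "(1 - hamming_dist (n (F, k)) (t g (F, k)) id) * real (n (F, k)) \<le> 1 / 2 * real (n (F, k))"
      by (simp only: card_agree_hamming_dist[OF n])
    thus ?thesis using n[of "(F, k)"] by (simp add: mult_le_cancel_right)
  qed
  let ?P = "product_group ?B (\<lambda>\<beta>. sym_group (n \<beta>))"
  let ?N = "null_sequences ?B V n"
  interpret P: group ?P by (rule group_product_sym)
  have t: "t g \<in> carrier ?P" if "g \<in> carrier G" for g
    using perm[OF that] by (auto simp: PiE_iff sym_group_carrier)
  have tm: "t (g \<otimes>\<^bsub>G\<^esub> h) \<otimes>\<^bsub>?P\<^esub> inv\<^bsub>?P\<^esub> (t g \<otimes>\<^bsub>?P\<^esub> t h) \<in> ?N"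
    if g: "g \<in> carrier G" and h: "h \<in> carrier G" for g h
  proof -
    have "((\<lambda>\<beta>. hamming_dist (n \<beta>) (t (g \<otimes>\<^bsub>G\<^esub> h) \<beta>) (t g \<beta> \<circ> t h \<beta>)) \<longlongrightarrow> 0) V"
    proof (rule tendstoI)
      fix \<epsilon> :: real assume "0 < \<epsilon>"
      then obtain k0 where k0: "inverse (real (Suc k0)) < \<epsilon>"
        using reals_Archimedean by blast
      show "eventually (\<lambda>\<beta>. dist (hamming_dist (n \<beta>) (t (g \<otimes>\<^bsub>G\<^esub> h) \<beta>) (t g \<beta> \<circ> t h \<beta>)) 0 < \<epsilon>) V"
      proof (rule ev[of "{g, h}" k0])
        fix F k assume F: "finite F" "{g, h} \<subseteq> F" and k: "k0 \<le> (k::nat)"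
        note defect[OF F g h, of k]
        also have "inverse (real (Suc k)) \<le> inverse (real (Suc k0))"
          using k by (intro le_imp_inverse_le) auto
        also note k0
        finally show "dist (hamming_dist (n (F, k)) (t (g \<otimes>\<^bsub>G\<^esub> h) (F, k)) (t g (F, k) \<circ> t h (F, k))) 0 < \<epsilon>"
          by (simp add: hamming_dist_nonneg)
      qed simp
    qed
    moreover have "t (g \<otimes>\<^bsub>G\<^esub> h) \<otimes>\<^bsub>?P\<^esub> inv\<^bsub>?P\<^esub> (t g \<otimes>\<^bsub>?P\<^esub> t h) \<in> carrier ?P"
      by (intro P.m_closed P.inv_closed t G.m_closed g h)
    hence "t (g \<otimes>\<^bsub>G\<^esub> h) \<otimes>\<^bsub>?P\<^esub> inv\<^bsub>?P\<^esub> (t g \<otimes>\<^bsub>?P\<^esub> t h) \<in> ?N \<longleftrightarrow>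
        ((\<lambda>\<beta>. hamming_dist (n \<beta>) (t (g \<otimes>\<^bsub>G\<^esub> h) \<beta>) (t g \<beta> \<circ> t h \<beta>)) \<longlongrightarrow> 0) V"
      by (rule null_sequences_iff[OF V(2) _ defect_hamming_dist]) (use t g h G.m_closed in blast)+
    ultimately show ?thesis by blast
  qed
  have t1: "t g \<notin> ?N" if g: "g \<in> carrier G" "g \<noteq> \<one>\<^bsub>G\<^esub>" for g
  proof
    assume "t g \<in> ?N"
    hence "((\<lambda>\<beta>. hamming_dist (n \<beta>) (t g \<beta>) id) \<longlongrightarrow> 0) V"
      by (simp add: null_sequences_def)
    hence "eventually (\<lambda>\<beta>. hamming_dist (n \<beta>) (t g \<beta>) id < 1 / 2) V"
      by (rule order_tendstoD(2)) simp
    moreover have "eventually (\<lambda>\<beta>. 1 / 2 \<le> hamming_dist (n \<beta>) (t g \<beta>) id) V"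
      by (rule ev[of "{g}" 0]) (use separated g in auto)
    ultimately have "eventually (\<lambda>_. False) V" by eventually_elim simp
    thus False using V(2) by (simp add: ultrafilter_on_def trivial_limit_def)
  qed
  have "\<exists>K. subgroup K (?P Mod ?N) \<and> G \<cong> (?P Mod ?N)\<lparr>carrier := K\<rparr>"
    unfolding embeds_in_factor_iff[OF G null_sequences_normal[OF V(2)]]
    using t tm t1 by (intro exI[of _ t]) blast
  hence "sofic_wrt ?B V n G"
    using V(2) n by (auto simp: sofic_wrt_def metric_ultraproduct_def)
  thus ?thesis unfolding sofic_def by blast
qed

section \<open>Permanence properties of soficity\<close>

context group
begin

text \<open>An approximation is tested only on \<open>F\<close> and on products of two of its
  elements, all of which lie in \<open>K\<close>. Outside \<open>K\<close> the identity is good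
  enough.\<close>

lemma sofic_if_locally_sofic:
  assumes local: "\<And>F. finite F \<Longrightarrow> F \<subseteq> carrier G \<Longrightarrow>
    \<exists>K. subgroup K G \<and> F \<subseteq> K \<and> sofic (G\<lparr>carrier := K\<rparr>)"
  shows "sofic G"
proof (rule approx_rep_imp_sofic[OF is_group])
  fix F and \<epsilon> :: real assume F: "finite F" "F \<subseteq> carrier G" and \<epsilon>: "0 < \<epsilon>"
  obtain K where K: "subgroup K G" "F \<subseteq> K" "sofic (G\<lparr>carrier := K\<rparr>)"
    using local[OF F] by blast
  obtain n t where t: "approx_rep (G\<lparr>carrier := K\<rparr>) F \<epsilon> (1 / 2) {1..n::nat} t"
    by (rule sofic_imp_approx_rep[OF subgroup_imp_group[OF K(1)] K(3) F(1) _ \<epsilon>])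
       (use K(2) in simp_all)
  have "approx_rep G F \<epsilon> (1 / 2) {1..n} (\<lambda>g. if g \<in> K then t g else id)"
    unfolding approx_rep_def
  proof (intro conjI ballI impI)
    fix g h assume "g \<in> F" "h \<in> F"
    moreover from this have "g \<in> K" "h \<in> K" "g \<otimes> h \<in> K"
      using K(1,2) by (auto intro: subgroup.m_closed)
    ultimately show "(1 - \<epsilon>) * real (card {1..n}) \<le> real (card {x \<in> {1..n}.
        (if g \<otimes> h \<in> K then t (g \<otimes> h) else id) x
        = (if g \<in> K then t g else id) ((if h \<in> K then t h else id) x)})"
      using t by (simp add: approx_rep_def)
  qed (use t K(2) in \<open>auto simp: approx_rep_def\<close>)
  thus "\<exists>(X :: nat set) s. approx_rep G F \<epsilon> (1 / 2) X s" by blast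
qed

text \<open>The approximations of \<open>L\<close> are induced up to \<open>G\<close> along the coset cocycle.\<close>

lemma sofic_if_finite_index_sofic:
  assumes L: "subgroup L G" "finite_index L G" and sof: "sofic (G\<lparr>carrier := L\<rparr>)"
  shows "sofic G"
proof (rule approx_rep_imp_sofic[OF is_group])
  fix F and \<epsilon> :: real assume F: "finite F" "F \<subseteq> carrier G" and \<epsilon>: "0 < \<epsilon>"
  obtain \<sigma> where "transversal G L \<sigma>" using L(1) by (rule transversal_exists)
  then interpret transversal G L \<sigma> .
  let ?Y = "rcosets L"
  have finY: "finite ?Y" using L(2) by (simp add: finite_index_def)
  \<comment> \<open>These are the finitely many elements of \<open>L\<close> through which
    \<open>F\<close> acts on the fibres over the cosets.\<close>
  let ?F' = "(\<lambda>(h, y). cocycle h y) ` (F \<times> ?Y)"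
  have F': "finite ?F'" "?F' \<subseteq> L"
    using F finY cocycle_in_subgroup by auto
  obtain n t where t: "approx_rep (G\<lparr>carrier := L\<rparr>) ?F' \<epsilon> (1 / 2) {1..n::nat} t"
    by (rule sofic_imp_approx_rep[OF subgroup_imp_group[OF L(1)] sof F'(1) _ \<epsilon>])
       (use F'(2) in simp_all)
  let ?X = "{1..n}"
  define u where "u = (\<lambda>h (y, x). (y #> inv h, t (cocycle h y) x))"
  have agree: "(1 - \<epsilon>) * real (card ?X) \<le> real (card {x\<in>?X. t (a \<otimes> b) x = t a (t b x)})"
    if "a \<in> ?F'" "b \<in> ?F'" for a b
  proof -
    have "\<forall>a\<in>?F'. \<forall>b\<in>?F'.
        (1 - \<epsilon>) * real (card ?X) \<le> real (card {x\<in>?X. t (a \<otimes> b) x = t a (t b x)})"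
      using t by (simp add: approx_rep_def)
    thus ?thesis using that by blast
  qed
  have bij: "bij_betw (t g) ?X ?X" if "g \<in> L" for g using t that by (simp add: approx_rep_def)
  have "approx_rep G F \<epsilon> (1 / 2) (?Y \<times> ?X) u"
    unfolding approx_rep_def
  proof (intro conjI ballI impI)
    show "finite (?Y \<times> ?X)" using finY by simp
    show "?Y \<times> ?X \<noteq> {}" using t subgroup_in_rcosets[OF is_group] by (auto simp: approx_rep_def)
    show "bij_betw (u h) (?Y \<times> ?X) (?Y \<times> ?X)" if h: "h \<in> carrier G" for h
    proof -
      \<comment> \<open>On a finite set injectivity suffices: the coset is recovered by translating
        back, then the point from the single bijection \<open>t (cocycle h y)\<close>.\<close>
      have "inj_on (u h) (?Y \<times> ?X)"
      proof (rule inj_onI, clarify)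
        fix y x y' x' assume y: "y \<in> ?Y" "y' \<in> ?Y" and x: "x \<in> ?X" "x' \<in> ?X"
          and eq: "u h (y, x) = u h (y', x')"
        have "(y #> inv h) #> h = (y' #> inv h) #> h" using eq by (simp add: u_def)
        hence "y = y'" using act_inv(1) y h by simp
        moreover from this have "x = x'"
          using eq x bij_betw_imp_inj_on[OF bij[OF cocycle_in_subgroup[OF y(1) h]]]
          by (auto simp: u_def dest: inj_onD)
        ultimately show "y = y' \<and> x = x'" by blast
      qed
      moreover have "u h ` (?Y \<times> ?X) \<subseteq> ?Y \<times> ?X"
        using act_closed h bij_betwE[OF bij[OF cocycle_in_subgroup[OF _ h]]]
        by (auto simp: u_def simp del: atLeastAtMost_iff)
      ultimately show ?thesis
        using finY by (simp add: bij_betw_def endo_inj_surj)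
    qed
    show "(1 - \<epsilon>) * real (card (?Y \<times> ?X))
        \<le> real (card {p \<in> ?Y \<times> ?X. u (g \<otimes> h) p = u g (u h p)})" if gh: "g \<in> F" "h \<in> F" for g h
    proof -
      have c: "g \<in> carrier G" "h \<in> carrier G" using gh F by auto
      let ?A = "\<lambda>y. {x\<in>?X. t (cocycle g (y #> inv h) \<otimes> cocycle h y) x
          = t (cocycle g (y #> inv h)) (t (cocycle h y) x)}"
      \<comment> \<open>The coset components always agree, so by the cocycle identity the defect
        over \<open>y\<close> is that of \<open>t\<close> at two elements of
        \<open>?F'\<close>.\<close>
      have "{p \<in> ?Y \<times> ?X. u (g \<otimes> h) p = u g (u h p)} = Sigma ?Y ?A"
        using c by (auto simp: u_def act_mult cocycle_mult)
      hence "real (card {p \<in> ?Y \<times> ?X. u (g \<otimes> h) p = u g (u h p)}) = (\<Sum>y\<in>?Y. real (card (?A y)))"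
        using finY by simp
      moreover have "real (card ?Y) * ((1 - \<epsilon>) * real (card ?X)) \<le> (\<Sum>y\<in>?Y. real (card (?A y)))"
      proof (rule sum_bounded_below)
        fix y assume y: "y \<in> ?Y"
        have "cocycle g (y #> inv h) \<in> ?F'" "cocycle h y \<in> ?F'"
          using gh y act_closed[OF y c(2)] by auto
        thus "(1 - \<epsilon>) * real (card ?X) \<le> real (card (?A y))"
          by (rule agree)
      qed
      ultimately show ?thesis by (simp add: card_cartesian_product mult_ac)
    qed
    show "real (card {p \<in> ?Y \<times> ?X. u h p = p}) \<le> 1 / 2 * real (card (?Y \<times> ?X))"
      if h: "h \<in> F" "h \<noteq> \<one>" for h
    proof -
      have c: "h \<in> carrier G" using h F by auto
      \<comment> \<open>Fixed points occur only over fixed cosets, where the cocycle is non-trivial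
        and the bound for \<open>t\<close> applies.\<close>
      let ?A = "\<lambda>y. if y #> inv h = y then {x\<in>?X. t (cocycle h y) x = x} else {}"
      have "{p \<in> ?Y \<times> ?X. u h p = p} = Sigma ?Y ?A" by (auto simp: u_def split: if_splits)
      hence "real (card {p \<in> ?Y \<times> ?X. u h p = p}) = (\<Sum>y\<in>?Y. real (card (?A y)))"
        using finY by simp
      also have "\<dots> \<le> real (card ?Y) * (1 / 2 * real (card ?X))"
      proof (rule sum_bounded_above)
        fix y assume y: "y \<in> ?Y"
        show "real (card (?A y)) \<le> 1 / 2 * real (card ?X)"
        proof (cases "y #> inv h = y")
          case True
          have "cocycle h y \<noteq> \<one>" using cocycle_fixed_point[OF y c h(2) True] .
          hence "real (card {x\<in>?X. t (cocycle h y) x = x}) \<le> 1 / 2 * real (card ?X)"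
            using t h(1) y by (simp add: approx_rep_def)
          thus ?thesis using True by simp
        qed simp
      qed
      finally show ?thesis by (simp add: card_cartesian_product mult_ac)
    qed
  qed
  thus "\<exists>(X :: ('a set \<times> nat) set) s. approx_rep G F \<epsilon> (1 / 2) X s" by blast
qed

text \<open>Finitely many non-trivial elements are avoided at once by intersecting normal subgroups
  of finite index that avoid them one by one.\<close>

lemma residually_finite_separates:
  assumes "residually_finite G" "finite F" "F \<subseteq> carrier G"
  obtains N where "N \<lhd> G" "finite_index N G" "N \<inter> F \<subseteq> {\<one>}"
proof -
  have "\<exists>N. N \<lhd> G \<and> finite_index N G \<and> N \<inter> F \<subseteq> {\<one>}"
    using assms(2,3)
  proof induction
    case empty
    show ?case using normal_self finite_index_self by blast
  next
    case (insert x F)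
    then obtain N where N: "N \<lhd> G" "finite_index N G" "N \<inter> F \<subseteq> {\<one>}" by auto
    show ?case
    proof (cases "x = \<one>")
      case True
      thus ?thesis using N by blast
    next
      case False
      then obtain M where M: "M \<lhd> G" "finite_index M G" "x \<notin> M"
        using assms(1) insert.prems by (auto simp: residually_finite_def)
      have "finite_index (N \<inter> M) G"
        using N M by (intro finite_index_Int normal_imp_subgroup)
      thus ?thesis using normal_subgroup_intersect[OF N(1) M(1)] N(3) M(3) by blast
    qed
  qed
  thus thesis using that by blast
qed

text \<open>Choose \<open>N\<close> avoiding the non-trivial elements of \<open>F\<close> and let
  \<open>G\<close> act on the cosets of \<open>N\<close>. The action is exactly multiplicative, and
  a coset fixed by \<open>h\<close> would put a conjugate of \<open>h\<close>, namely its cocycle,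
  into the normal subgroup \<open>N\<close>.\<close>

lemma residually_finite_imp_sofic:
  assumes "residually_finite G"
  shows "sofic G"
proof (rule approx_rep_imp_sofic[OF is_group])
  fix F and \<epsilon> :: real assume F: "finite F" "F \<subseteq> carrier G" and \<epsilon>: "0 < \<epsilon>"
  obtain N where N: "N \<lhd> G" "finite_index N G" "N \<inter> F \<subseteq> {\<one>}"
    using residually_finite_separates[OF assms F] .
  interpret N: normal N G by (rule N(1))
  let ?Y = "rcosets N"
  have finY: "finite ?Y" using N(2) by (simp add: finite_index_def)
  obtain \<sigma> where "transversal G N \<sigma>" using N.subgroup_axioms by (rule transversal_exists)
  then interpret T: transversal G N \<sigma> .
  have no_fixed: "y #> inv h \<noteq> y" if h: "h \<in> F" "h \<noteq> \<one>" and y: "y \<in> ?Y" for h y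
  proof
    assume "y #> inv h = y"
    have hc: "h \<in> carrier G" using h(1) F(2) by blast
    have s: "\<sigma> y \<in> carrier G" using y by (rule T.representative_closed)
    have "\<sigma> y \<otimes> h \<otimes> inv (\<sigma> y) \<in> N"
      using T.cocycle_in_subgroup[OF y hc] \<open>y #> inv h = y\<close> by (simp add: T.cocycle_def)
    from N.inv_op_closed1[OF s this] have "h \<in> N"
      using s hc by (simp add: m_assoc) (simp add: m_assoc[symmetric])
    thus False using N(3) h by blast
  qed
  have "approx_rep G F \<epsilon> (1 / 2) ?Y (\<lambda>h y. y #> inv h)"
    unfolding approx_rep_def
  proof (intro conjI ballI impI)
    show "?Y \<noteq> {}" using N.subgroup_in_rcosets[OF is_group] by blast
    show "bij_betw (\<lambda>y. y #> inv h) ?Y ?Y" if "h \<in> carrier G" for h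
      using that T.act_closed rcosets_act_closed[OF N.subset] T.act_inv
      by (intro bij_betwI[where g = "\<lambda>y. y #> h"]) auto
    show "(1 - \<epsilon>) * real (card ?Y)
        \<le> real (card {y \<in> ?Y. y #> inv (g \<otimes> h) = (y #> inv h) #> inv g})"
      if "g \<in> F" "h \<in> F" for g h
    proof -
      have "{y \<in> ?Y. y #> inv (g \<otimes> h) = (y #> inv h) #> inv g} = ?Y"
        using that F(2) T.act_mult by blast
      thus ?thesis using \<epsilon> by (simp add: left_diff_distrib)
    qed
    show "real (card {y \<in> ?Y. y #> inv h = y}) \<le> 1 / 2 * real (card ?Y)"
      if "h \<in> F" "h \<noteq> \<one>" for h
    proof -
      have none: "{y \<in> ?Y. y #> inv h = y} = {}" using no_fixed[OF that] by blast
      show ?thesis unfolding none by simp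
    qed
  qed (rule finY)
  thus "\<exists>(X :: 'a set set) s. approx_rep G F \<epsilon> (1 / 2) X s" by blast
qed

section \<open>Finitely generated non-sofic groups and their descending chains\<close>

lemma nonsofic_finitely_generated_subgroup:
  assumes "\<not> sofic G"
  obtains H where "subgroup H G" "finitely_generated (G\<lparr>carrier := H\<rparr>)"
    "\<not> sofic (G\<lparr>carrier := H\<rparr>)"
proof -
  \<comment> \<open>Since local soficity fails, some finite \<open>F\<close> lies in no sofic
    subgroup, in particular not in a sofic \<open>generate G F\<close>.\<close>
  obtain F where F: "finite F" "F \<subseteq> carrier G"
    and K: "\<And>K. subgroup K G \<Longrightarrow> F \<subseteq> K \<Longrightarrow> \<not> sofic (G\<lparr>carrier := K\<rparr>)"
    using assms sofic_if_locally_sofic by blast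
  have H: "subgroup (generate G F) G" using F(2) by (rule generate_is_subgroup)
  have FH: "F \<subseteq> generate G F" by (auto intro: generate.incl)
  have "finitely_generated (G\<lparr>carrier := generate G F\<rparr>)"
    unfolding finitely_generated_def
    using F(1) FH generate_consistent[OF FH H] by (intro exI[of _ F]) simp
  thus thesis using that[OF H] K[OF H FH] by blast
qed

lemma locally_graded_subgroup:
  assumes H: "subgroup H G" and "locally_graded G"
  shows "locally_graded (G\<lparr>carrier := H\<rparr>)"
  using assms(2) incl_subgroup[OF H] by (simp add: locally_graded_def)

text \<open>If \<open>M\<close> were trivial, it would itself witness residual finiteness of
  \<open>G\<close>. By Schreier \<open>M\<close> is finitely generated, so it has a proper subgroup
  of finite index, whose normal core in \<open>G\<close> is the required \<open>M'\<close>.\<close>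

lemma locally_graded_proper_normal:
  assumes lg: "locally_graded G" and fg: "finitely_generated G" and nonsofic: "\<not> sofic G"
    and M: "M \<lhd> G" "finite_index M G"
  obtains M' where "M' \<lhd> G" "finite_index M' G" "M' \<subset> M"
proof -
  have subM: "subgroup M G" using M(1) by (rule normal_imp_subgroup)
  have "M \<noteq> {\<one>}"
  proof
    assume "M = {\<one>}"
    hence "residually_finite G" using M by (auto simp: residually_finite_def)
    thus False using nonsofic residually_finite_imp_sofic by blast
  qed
  then obtain L where L: "subgroup L (G\<lparr>carrier := M\<rparr>)" "L \<noteq> M" "finite_index L (G\<lparr>carrier := M\<rparr>)"
    using lg subM finitely_generated_finite_index[OF fg subM M(2)]
    by (auto simp: locally_graded_def)
  obtain M' where "M' \<lhd> G" "finite_index M' G" "M' \<subseteq> L"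
    using finite_index_core[OF incl_subgroup[OF subM L(1)] finite_index_trans[OF subM M(2) L(1,3)]] .
  moreover have "L \<subset> M" using subgroup.subset[OF L(1)] L(2) by auto
  ultimately show thesis using that by blast
qed

lemma nonsofic_descending_chain:
  assumes lg: "locally_graded G" and fg: "finitely_generated G" and nonsofic: "\<not> sofic G"
  obtains N :: "nat \<Rightarrow> 'a set" where "N 0 = carrier G" "\<And>i. N (Suc i) \<subset> N i" "\<And>i. N i \<lhd> G"
    "\<And>i. finitely_generated (G\<lparr>carrier := N i\<rparr>)" "\<And>i. \<not> sofic (G\<lparr>carrier := N i\<rparr>)"
    "(\<Inter>i. N i) \<noteq> {\<one>}" "(\<Inter>i. N i) \<subseteq> profinite_residual G"
    "residually_finite (G Mod (\<Inter>i. N i))"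
proof -
  let ?S = "{N. N \<lhd> G \<and> finite_index N G}"
  have ne: "?S \<noteq> {}" using normal_self finite_index_self by blast
  have "countable ?S"
    by (rule countable_subset[OF _ countable_finite_index_subgroups[OF fg]])
       (auto intro: normal_imp_subgroup)
  then obtain A :: "nat \<Rightarrow> 'a set" where A: "range A = ?S"
    using range_from_nat_into[OF ne] by blast
  \<comment> \<open>\<open>?P\<close> fixes the start of the chain and keeps its members normal of
    finite index; \<open>?Q\<close> asks for strict descent and for entry into the next enumerated
    subgroup \<open>A i\<close>.\<close>
  let ?P = "\<lambda>i X. X \<in> ?S \<and> (i = 0 \<longrightarrow> X = carrier G)"
  let ?Q = "\<lambda>i X Y. Y \<subset> X \<and> Y \<subseteq> A i"
  have "\<exists>N. \<forall>i :: nat. ?P i (N i) \<and> ?Q i (N i) (N (Suc i))"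
  proof (rule dependent_nat_choice)
    show "\<exists>X. ?P 0 X" using normal_self finite_index_self by blast
    fix X and i :: nat assume "?P i X"
    then obtain Y where Y: "Y \<lhd> G" "finite_index Y G" "Y \<subset> X"
      using locally_graded_proper_normal[OF lg fg nonsofic, of X] by blast
    have Ai: "A i \<lhd> G" "finite_index (A i) G" using A by blast+
    have "finite_index (Y \<inter> A i) G"
      using Y Ai by (intro finite_index_Int normal_imp_subgroup)
    \<comment> \<open>Strictness comes from \<open>Y\<close> and survives the intersection even if
      \<open>A i\<close> contains \<open>Y\<close>.\<close>
    thus "\<exists>Y. ?P (Suc i) Y \<and> ?Q i X Y"
      using normal_subgroup_intersect[OF Y(1) Ai(1)] Y(3) by (intro exI[of _ "Y \<inter> A i"]) auto
  qed
  then obtain N where "\<forall>i :: nat. ?P i (N i) \<and> ?Q i (N i) (N (Suc i))" by blast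
  hence N: "N i \<lhd> G" "finite_index (N i) G" "N 0 = carrier G"
    and desc: "N (Suc i) \<subset> N i" and NA: "N (Suc i) \<subseteq> A i" for i
    by blast+
  have sub: "subgroup (N i) G" for i using N(1) by (rule normal_imp_subgroup)
  show thesis
  proof (rule that[of N])
    show "finitely_generated (G\<lparr>carrier := N i\<rparr>)" for i
      using fg sub N(2) by (rule finitely_generated_finite_index)
    show "\<not> sofic (G\<lparr>carrier := N i\<rparr>)" for i
      using nonsofic sofic_if_finite_index_sofic[OF sub N(2)] by blast
    show "(\<Inter>i. N i) \<noteq> {\<one>}"
    proof
      \<comment> \<open>With trivial intersection the \<open>N i\<close> themselves would separate
        all non-trivial elements from the identity.\<close>
      assume "(\<Inter>i. N i) = {\<one>}"
      hence "residually_finite G" using N(1,2) unfolding residually_finite_def by blast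
      thus False using nonsofic residually_finite_imp_sofic by blast
    qed
    \<comment> \<open>Every normal subgroup of finite index is some \<open>A i\<close> and so
      contains \<open>N (Suc i)\<close>.\<close>
    show "(\<Inter>i. N i) \<subseteq> profinite_residual G"
      unfolding profinite_residual_def A[symmetric] using NA by blast
    show "residually_finite (G Mod (\<Inter>i. N i))"
      using N(1,2) by (rule residually_finite_quotient)
  qed (use N desc in auto)
qed

end

theorem theorem1p10:
  fixes G :: "('a, 'b) monoid_scheme"
  assumes "group G"
    and "locally_graded G"
    and "\<not> sofic G"
  shows "(\<exists>H (N :: nat \<Rightarrow> 'a set).
            subgroup H G \<and>
            finitely_generated (G\<lparr>carrier := H\<rparr>) \<and>
            \<not> sofic (G\<lparr>carrier := H\<rparr>) \<and>
            N 0 = H \<and>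
            (\<forall>i. N (Suc i) \<subset> N i) \<and>
            (\<forall>i. N i \<lhd> G\<lparr>carrier := H\<rparr> \<and> finitely_generated (G\<lparr>carrier := N i\<rparr>)) \<and>
            (\<forall>i. \<not> sofic (G\<lparr>carrier := N i\<rparr>)) \<and>
            (\<Inter>i. N i) \<noteq> {\<one>\<^bsub>G\<^esub>} \<and>
            (\<Inter>i. N i) \<subseteq> profinite_residual (G\<lparr>carrier := H\<rparr>) \<and>
            residually_finite (G\<lparr>carrier := H\<rparr> Mod (\<Inter>i. N i)))
         \<and> omega_non_sofic G"
proof -
  interpret group G by fact
  obtain H where H: "subgroup H G" "finitely_generated (G\<lparr>carrier := H\<rparr>)"
      "\<not> sofic (G\<lparr>carrier := H\<rparr>)"
    using assms(3) by (rule nonsofic_finitely_generated_subgroup)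
  interpret H: group "G\<lparr>carrier := H\<rparr>" using H(1) by (rule subgroup_imp_group)
  obtain N :: "nat \<Rightarrow> 'a set" where N: "N 0 = carrier (G\<lparr>carrier := H\<rparr>)"
    "\<And>i. N (Suc i) \<subset> N i" "\<And>i. N i \<lhd> G\<lparr>carrier := H\<rparr>"
    "\<And>i. finitely_generated ((G\<lparr>carrier := H\<rparr>)\<lparr>carrier := N i\<rparr>)"
    "\<And>i. \<not> sofic ((G\<lparr>carrier := H\<rparr>)\<lparr>carrier := N i\<rparr>)"
    "(\<Inter>i. N i) \<noteq> {\<one>\<^bsub>G\<lparr>carrier := H\<rparr>\<^esub>}"
    "(\<Inter>i. N i) \<subseteq> profinite_residual (G\<lparr>carrier := H\<rparr>)"
    "residually_finite (G\<lparr>carrier := H\<rparr> Mod (\<Inter>i. N i))"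
    by (rule H.nonsofic_descending_chain[OF locally_graded_subgroup[OF H(1) assms(2)] H(2,3)])
       (rule that)
  \<comment> \<open>Normality holds only in \<open>H\<close>, but being a subgroup passes up to
    \<open>G\<close>, so the same chain witnesses \<open>omega_non_sofic G\<close>.\<close>
  have "subgroup (N i) G" for i
    using incl_subgroup[OF H(1) normal_imp_subgroup[OF N(3)]] .
  hence "\<forall>i. subgroup (N i) G \<and> \<not> sofic (G\<lparr>carrier := N i\<rparr>) \<and> N (Suc i) \<subset> N i"
    using N(2,5) by simp
  hence "omega_non_sofic G"
    unfolding omega_non_sofic_def using assms(3) by blast
  thus ?thesis
    using H N by (intro conjI exI[of _ H] exI[of _ N] allI) simp_all
qed

end
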